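(* Let $G=(V,E)$ be a finite simple strongly connected directed graph, and fix a total order on $V$. Then $$\det(\mathcal L)=\prod_{\substack{W\subseteq V\\ W\text{ strongly connected}}}\det(L_W)^{m(W)},$$ the product being over all nonempty strongly connected subsets $W\subseteq V$ (including $W=V$), where $m(W)=m(W,w)$ for any $w\in W$ (this number does not depend on the choice of $w\in W$).
   Context: Setup. $G=(V,E)$ is a finite simple directed graph (no multiple edges, no loops); $s(e),t(e)$ denote the source and target of an edge $e$. For $W\subseteq V$, $G_W$ is the induced subgraph on $W$; $W$ is strongly connected if $G_W$ is. Let $x_e$ ($e\in E$) and $y_v$ ($v\in V$) be independent indeterminates. The weighted Laplacian $Q$ is the $V\times V$ matrix with $Q_{vw}=x_e$ if $v\neq w$ and $e$ is an edge from $v$ to $w$ (and $0$ if there is no such edge), and $Q_{vv}=-\sum_{e:s(e)=v}x_e$. The Schrödinger operator is $L=Q+Y$ where $Y$ is diagonal with $Y_{vv}=y_v$. For $W\subseteq V$, $L_W$ is the submatrix of $L$ with rows and columns indexed by $W$. Spanning trees. An (oriented) spanning tree of $G$ is a subgraph containing all vertices, with no cycle, in which one vertex (the root) has outdegree $0$ and every other vertex has outdegree $1$. The tree graph $\mathcal TG$ has as vertex set the set $\mathcal TV$ of spanning trees of $G$; for a tree $\mathbf a$ with root $r$ and an edge $e\in E$ with $s(e)=r$, let $\mathbf b$ be obtained from $\mathbf a$ by adding $e$ and deleting the edge of $\mathbf a$ going out of $t(e)$ ($\mathbf b$ is a spanning tree rooted at $t(e)$); then $\mathbf a\to\mathbf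 b$ is an edge of $\mathcal TG$, with weight $x_e$. The lifted Schrödinger operator $\mathcal L$ is the $\mathcal TV\times\mathcal TV$ matrix with $\mathcal L_{\mathbf a\mathbf b}=x_e$ if $\mathbf a\to\mathbf b$ is an edge of $\mathcal TG$ constructed from $e$, $\mathcal L_{\mathbf a\mathbf c}=0$ if $\mathbf a\ne\mathbf c$ and there is no edge $\mathbf a\to\mathbf c$, and $\mathcal L_{\mathbf a\mathbf a}=-\sum_{e:s(e)=r}x_e+y_r$ where $r$ is the root of $\mathbf a$. Exploration algorithm (depends on the fixed total order of $V$). Input: a spanning tree $\mathbf a$ rooted at $v$. Running variables: a set $A$ of vertices, a first-in-first-out list $\mathbf L$ of edges, a set $F$ of edges. Initialization: $A=\{v\}$, $F=\{e\in E: s(e)\neq v\}$, $\mathbf L=$ the edges with target $v$, ordered by increasing source. Iteration: while $\mathbf L$ is nonempty, take the first edge $e$ of $\mathbf L$, with source $w$. If $e$ belongs to $\mathbf a$: add $w$ to $A$; delete from $\mathbf L$ (and from $F$) all edges with source $w$; append at the end of $\mathbf L$ all edges of $F$ with target $w$, by increasing source. Otherwise: delete from $\mathbf L$ and from $F$ all edges with source or target $w$ (one says $w$ is erased). Termination: $\phi(\mathbf a)$ is the final value of $A$, and $\psi(\mathbf a)$ is the strongly connected component of $v$ in the induced subgraph $G_{\phi(\mathbf a)}$. Multiplicities. For a strongly connected $W\subseteq V$ and $w\in W$, $m(W,w)$ is the number of spanning trees $\mathbf a$ of $G$ rooted at $w$ with $\psi(\mathbf a)=W$. *)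

theory Defs
  imports "HOL-Combinatorics.Permutations" "HOL-Library.While_Combinator"
begin

text \<open>Graph: finite vertex set V of a linearly ordered type (the total order of V),
  edges E as a set of pairs (source, target). Entries in an arbitrary commutative ring.\<close>

definition det_on :: "'i set \<Rightarrow> ('i \<Rightarrow> 'i \<Rightarrow> 'r::comm_ring_1) \<Rightarrow> 'r" where
  "det_on S M = (\<Sum>p | p permutes S. of_int (sign p) * (\<Prod>i\<in>S. M i (p i)))"

definition strongly_connected_set :: "'v set \<Rightarrow> ('v \<times> 'v) set \<Rightarrow> 'v set \<Rightarrow> bool" where
  "strongly_connected_set V E W \<longleftrightarrow> W \<noteq> {} \<and> W \<subseteq> V \<and>
     (\<forall>u\<in>W. \<forall>w\<in>W. (u, w) \<in> (E \<inter> (W \<times> W))\<^sup>*)"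

definition schroedinger :: "('v \<times> 'v) set \<Rightarrow> ('v \<times> 'v \<Rightarrow> 'r::comm_ring_1) \<Rightarrow> ('v \<Rightarrow> 'r)
    \<Rightarrow> 'v \<Rightarrow> 'v \<Rightarrow> 'r" where
  "schroedinger E x y v w =
     (if v = w then - (\<Sum>e\<in>{e\<in>E. fst e = v}. x e) + y v
      else if (v, w) \<in> E then x (v, w) else 0)"

definition spanning_tree_rooted :: "'v set \<Rightarrow> ('v \<times> 'v) set \<Rightarrow> ('v \<times> 'v) set \<Rightarrow> 'v \<Rightarrow> bool" where
  "spanning_tree_rooted V E T r \<longleftrightarrow> T \<subseteq> E \<and> r \<in> V \<and> acyclic T \<and>
     (\<forall>e\<in>T. fst e \<noteq> r) \<and>
     (\<forall>v\<in>V - {r}. \<exists>!e. e \<in> T \<and> fst e = v)"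

definition spanning_trees :: "'v set \<Rightarrow> ('v \<times> 'v) set \<Rightarrow> ('v \<times> 'v) set set" where
  "spanning_trees V E = {T. \<exists>r. spanning_tree_rooted V E T r}"

definition tree_root :: "'v set \<Rightarrow> ('v \<times> 'v) set \<Rightarrow> ('v \<times> 'v) set \<Rightarrow> 'v" where
  "tree_root V E T = (THE r. spanning_tree_rooted V E T r)"

text \<open>The tree obtained from T (rooted at s(e)) by adding e and deleting the edge of T
  going out of t(e).\<close>
definition tree_move :: "('v \<times> 'v) set \<Rightarrow> ('v \<times> 'v) \<Rightarrow> ('v \<times> 'v) set" where
  "tree_move T e = insert e {d\<in>T. fst d \<noteq> snd e}"

definition lifted_schroedinger :: "'v set \<Rightarrow> ('v \<times> 'v) set \<Rightarrow> ('v \<times> 'v \<Rightarrow> 'r::comm_ring_1)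
    \<Rightarrow> ('v \<Rightarrow> 'r) \<Rightarrow> ('v \<times> 'v) set \<Rightarrow> ('v \<times> 'v) set \<Rightarrow> 'r" where
  "lifted_schroedinger V E x y a b =
     (if a = b then - (\<Sum>e\<in>{e\<in>E. fst e = tree_root V E a}. x e) + y (tree_root V E a)
      else (\<Sum>e\<in>{e\<in>E. fst e = tree_root V E a \<and> tree_move a e = b}. x e))"

text \<open>Exploration algorithm. State: (A, L, F).\<close>
definition explore_step :: "('v \<times> 'v) set \<Rightarrow> 'v::linorder set \<times> ('v \<times> 'v) list \<times> ('v \<times> 'v) set
    \<Rightarrow> 'v set \<times> ('v \<times> 'v) list \<times> ('v \<times> 'v) set" where
  "explore_step a st = (case st of (A, [], F) \<Rightarrow> (A, [], F)
     | (A, e # L, F) \<Rightarrow>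
        (let w = fst e in
         if e \<in> a then
           (let F' = {d\<in>F. fst d \<noteq> w};
                L' = filter (\<lambda>d. fst d \<noteq> w) (e # L)
            in (insert w A, L' @ map (\<lambda>u. (u, w)) (sorted_list_of_set {u. (u, w) \<in> F'}), F'))
         else
           (A, filter (\<lambda>d. fst d \<noteq> w \<and> snd d \<noteq> w) (e # L),
               {d\<in>F. fst d \<noteq> w \<and> snd d \<noteq> w})))"

definition explore_init :: "('v \<times> 'v) set \<Rightarrow> 'v::linorder
    \<Rightarrow> 'v set \<times> ('v \<times> 'v) list \<times> ('v \<times> 'v) set" where
  "explore_init E v = ({v}, map (\<lambda>u. (u, v)) (sorted_list_of_set {u. (u, v) \<in> E}),
                       {e\<in>E. fst e \<noteq> v})"

definition explore_phi :: "'v::linorder set \<Rightarrow> ('v \<times> 'v) set \<Rightarrow> ('v \<times> 'v) set \<Rightarrow> 'v set" where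
  "explore_phi V E a = fst (while (\<lambda>(A, L, F). L \<noteq> []) (explore_step a)
                                  (explore_init E (tree_root V E a)))"

definition explore_psi :: "'v::linorder set \<Rightarrow> ('v \<times> 'v) set \<Rightarrow> ('v \<times> 'v) set \<Rightarrow> 'v set" where
  "explore_psi V E a = (let A = explore_phi V E a; v = tree_root V E a;
       R = (E \<inter> (A \<times> A))\<^sup>* in {w\<in>A. (v, w) \<in> R \<and> (w, v) \<in> R})"

definition tree_mult :: "'v::linorder set \<Rightarrow> ('v \<times> 'v) set \<Rightarrow> 'v set \<Rightarrow> 'v \<Rightarrow> nat" where
  "tree_mult V E W w = card {a. spanning_tree_rooted V E a w \<and> explore_psi V E a = W}"

end

theory Submission
  imports Defs "Jordan_Normal_Form.Schur_Decomposition"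
begin

text \<open>
  Call an acyclic set of edges with exactly one edge out of every vertex outside \<open>U\<close> and none out of
  \<open>U\<close> a forest with root set \<open>U\<close>. For a closed walk in the graph with vertex set \<open>U\<close>, a tree rooted at
  the start returns to itself along the walk iff its edges out of \<open>U\<close> are the last exits of the walk;
  hence such trees correspond to the forests with root set \<open>U\<close>. On the other hand, for strongly
  connected \<open>U\<close> and \<open>w \<in> U\<close>, the trees \<open>a\<close> rooted at \<open>w\<close> with \<open>U \<subseteq> \<psi>(a)\<close> correspond to the same
  forests: the exploration must accept each examined edge out of \<open>U\<close>, so the edges of \<open>a\<close> out of \<open>U\<close>
  can be recovered from the others. Therefore the multiplicities \<open>m(W, w)\<close> with \<open>W \<supseteq> U\<close> add up to the
  number of forests with root set \<open>U\<close>. By induction on \<open>W\<close> they do not depend on \<open>w\<close>, and the trace of each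
  power of the lifted operator is the sum of \<open>m(W)\<close> times the trace of that power of \<open>L\<^sub>W\<close>. Over the
  complex numbers traces of powers determine eigenvalues with multiplicities, which gives the
  determinant formula; being a polynomial identity with integer coefficients, it holds in every
  commutative ring.
\<close>

section \<open>Determinants and traces of powers\<close>

text \<open>Matrices are functions on an index set, as in \<open>det_on\<close>, so that vertices
  and trees serve directly as indices. Peeling off the first factor matches the expansion of powers
  into walks.\<close>

primrec mpow :: "'i set \<Rightarrow> ('i \<Rightarrow> 'i \<Rightarrow> 'r::comm_ring_1) \<Rightarrow> nat \<Rightarrow> 'i \<Rightarrow> 'i \<Rightarrow> 'r" where
  "mpow S M 0 i j = (if i = j then 1 else 0)"
| "mpow S M (Suc k) i j = (\<Sum>l\<in>S. M i l * mpow S M k l j)"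

definition trace_pow :: "'i set \<Rightarrow> ('i \<Rightarrow> 'i \<Rightarrow> 'r::comm_ring_1) \<Rightarrow> nat \<Rightarrow> 'r" where
  "trace_pow S M k = (\<Sum>i\<in>S. mpow S M k i i)"

text \<open>Bridges to the matrix power \<open>^\<^sub>m\<close>, which adds its new factor on the
  right.\<close>

lemma mpow_Suc_right:
  assumes "finite S" "i \<in> S" "j \<in> S"
  shows "mpow S M (Suc k) i j = (\<Sum>l\<in>S. mpow S M k i l * M l j)"
  using assms(2)
proof (induction k arbitrary: i)
  case 0
  have "(\<Sum>l\<in>S. M i l * (if l = j then 1 else 0)) = (\<Sum>l\<in>S. if l = j then M i j else 0)"
    "(\<Sum>l\<in>S. (if i = l then 1 else 0) * M l j) = (\<Sum>l\<in>S. if i = l then M i j else 0)"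
    by (auto intro!: sum.cong)
  then show ?case using 0 assms by simp
next
  case (Suc k)
  have "mpow S M (Suc (Suc k)) i j = (\<Sum>l\<in>S. M i l * (\<Sum>m\<in>S. mpow S M k l m * M m j))"
    unfolding mpow.simps(2)[of S M "Suc k"] by (intro sum.cong refl) (simp only: Suc.IH)
  also have "\<dots> = (\<Sum>m\<in>S. \<Sum>l\<in>S. M i l * (mpow S M k l m * M m j))"
    unfolding sum_distrib_left by (rule sum.swap)
  also have "\<dots> = (\<Sum>m\<in>S. mpow S M (Suc k) i m * M m j)"
    by (simp add: sum_distrib_right mult.assoc)
  finally show ?case .
qed

text \<open>Conjugation with \<open>h\<close> is a sign-preserving bijection between the
  permutations of \<open>T\<close> and those of \<open>S\<close>. It serves to number an index set
  by \<open>{0..<n}\<close>.\<close>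

lemma det_on_reindex:
  assumes "bij_betw h T S" "finite T"
  shows "det_on S M = det_on T (\<lambda>i j. M (h i) (h j))"
proof -
  have inj: "inj_on h T" and im: "h ` T = S"
    using assms(1) by (auto simp: bij_betw_def)
  let ?f = "map_permutation T h" and ?g = "map_permutation S (inv_into T h)"
  have gh: "bij_betw (inv_into T h) S T"
    by (rule bij_betw_inv_into[OF assms(1)])
  have "det_on S M = (\<Sum>p | p permutes T. of_int (sign (?f p)) * (\<Prod>i\<in>S. M i (?f p i)))"
    unfolding det_on_def
  proof (rule sum.reindex_bij_witness[of _ ?f ?g])
    fix p assume "p \<in> {p. p permutes S}"
    then have p: "p permutes S" by simp
    show "?f (?g p) = p"
      by (rule map_permutation_compose_inv[OF gh p]) (simp add: f_inv_into_f im)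
    show "?g p \<in> {p. p permutes T}"
      using map_permutation_permutes[OF gh p] by simp
    then show "of_int (sign (?f (?g p))) * (\<Prod>i\<in>S. M i (?f (?g p) i)) =
        of_int (sign p) * (\<Prod>i\<in>S. M i (p i))"
      using \<open>?f (?g p) = p\<close> by simp
  next
    fix p assume "p \<in> {p. p permutes T}"
    then have p: "p permutes T" by simp
    show "?g (?f p) = p"
      by (rule map_permutation_compose_inv[OF assms(1) p]) (simp add: inj)
    show "?f p \<in> {p. p permutes S}"
      using map_permutation_permutes[OF assms(1) p] by simp
  qed
  also have "\<dots> = det_on T (\<lambda>i j. M (h i) (h j))"
    unfolding det_on_def
  proof (rule sum.cong[OF refl])
    fix p assume "p \<in> {p. p permutes T}"
    then have p: "p permutes T" by simp
    have "(\<Prod>i\<in>S. M i (?f p i)) = (\<Prod>i\<in>T. M (h i) (h (p i)))"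
      unfolding im[symmetric] using inj
      by (simp add: prod.reindex map_permutation_apply)
    then show "of_int (sign (?f p)) * (\<Prod>i\<in>S. M i (?f p i)) =
        of_int (sign p) * (\<Prod>i\<in>T. M (h i) (h (p i)))"
      by (simp add: sign_map_permutation[OF inj p assms(2)])
  qed
  finally show ?thesis .
qed

section \<open>Complex eigenvalues and traces of powers\<close>

lemma sum_diag_mult_mat_commute:
  fixes X Y :: "'a::comm_ring_1 mat"
  assumes "X \<in> carrier_mat n n" "Y \<in> carrier_mat n n"
  shows "(\<Sum>i<n. (X * Y) $$ (i, i)) = (\<Sum>i<n. (Y * X) $$ (i, i))"
proof -
  have "(\<Sum>i<n. (X * Y) $$ (i, i)) = (\<Sum>i<n. \<Sum>j<n. X $$ (i, j) * Y $$ (j, i))"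
    using assms by (intro sum.cong refl) (auto simp: scalar_prod_def atLeast0LessThan)
  also have "\<dots> = (\<Sum>j<n. \<Sum>i<n. X $$ (i, j) * Y $$ (j, i))"
    by (rule sum.swap)
  also have "\<dots> = (\<Sum>j<n. (Y * X) $$ (j, j))"
    using assms by (intro sum.cong refl) (auto simp: scalar_prod_def atLeast0LessThan mult.commute)
  finally show ?thesis .
qed

text \<open>Both claims share one induction: in the product, terms with \<open>l < i\<close> vanish
  by the power and terms with \<open>j < l\<close> by \<open>B\<close>, so nothing is left for
  \<open>j < i\<close> and only \<open>l = i\<close> for \<open>j = i\<close>.\<close>

lemma upper_triangular_pow:
  fixes B :: "'a::comm_ring_1 mat"
  assumes "B \<in> carrier_mat n n" "upper_triangular B" "i < n" "j < n"
  shows "(j < i \<longrightarrow> (B ^\<^sub>m k) $$ (i, j) = 0) \<and> (i = j \<longrightarrow> (B ^\<^sub>m k) $$ (i, j) = (B $$ (i, i)) ^ k)"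
  using assms(3,4)
proof (induction k arbitrary: i j)
  case 0
  then show ?case using assms(1) by auto
next
  case (Suc k)
  have carrier: "B ^\<^sub>m k \<in> carrier_mat n n" using assms(1) by simp
  have eq: "(B ^\<^sub>m Suc k) $$ (i, j) = (\<Sum>l<n. (B ^\<^sub>m k) $$ (i, l) * B $$ (l, j))"
    using Suc.prems assms(1) carrier by (auto simp: scalar_prod_def atLeast0LessThan)
  have zero: "B $$ (l, j) = 0" if "j < l" "l < n" for l
    using that assms by auto
  have "(B ^\<^sub>m Suc k) $$ (i, j) = 0" if "j < i"
    unfolding eq
  proof (rule sum.neutral, safe)
    fix l assume "l < n"
    then show "(B ^\<^sub>m k) $$ (i, l) * B $$ (l, j) = 0"
      using Suc.IH[of i l] Suc.prems zero[of l] that by (cases "l < i") auto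
  qed
  moreover have "(B ^\<^sub>m Suc k) $$ (i, j) = (B $$ (i, i)) ^ Suc k" if "i = j"
  proof -
    have "(\<Sum>l<n. (B ^\<^sub>m k) $$ (i, l) * B $$ (l, j)) =
        (\<Sum>l<n. if l = i then (B $$ (i, i)) ^ Suc k else 0)"
    proof (intro sum.cong refl)
      fix l assume "l \<in> {..<n}"
      then show "(B ^\<^sub>m k) $$ (i, l) * B $$ (l, j) = (if l = i then (B $$ (i, i)) ^ Suc k else 0)"
        using Suc.IH[of i l] Suc.prems zero[of l] that
        by (cases l i rule: linorder_cases) (auto simp: mult.commute)
    qed
    then show ?thesis using eq Suc.prems by simp
  qed
  ultimately show ?case by blast
qed

text \<open>Complex characteristic polynomials split, so a Schur decomposition makes the matrix
  similar to an upper triangular one; \<open>es\<close> is the diagonal of the latter.\<close>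

lemma det_trace_pow_eigenvalues:
  fixes M :: "'i \<Rightarrow> 'i \<Rightarrow> complex"
  assumes "finite S"
  obtains es where "det_on S M = prod_list es"
    "\<And>k. trace_pow S M k = (\<Sum>e\<leftarrow>es. e ^ k)"
proof -
  define n where "n = card S"
  obtain h where h: "bij_betw h {0..<n} S"
    using ex_bij_betw_nat_finite[OF assms] unfolding n_def by blast
  define A where "A = mat n n (\<lambda>(i, j). M (h i) (h j))"
  have A: "A \<in> carrier_mat n n" by (simp add: A_def)
  have detA: "det_on S M = det A"
    unfolding det_on_reindex[OF h finite_atLeastLessThan] unfolding det_on_def det_def'[OF A]
    by (intro sum.cong refl arg_cong2[where f = "(*)"] prod.cong)
      (auto simp: A_def dest: permutes_in_image)
  have hS: "i < n \<Longrightarrow> h i \<in> S" for i using h by (auto simp: bij_betw_def)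
  have sumh: "(\<Sum>i\<in>S. g i) = (\<Sum>i<n. g (h i))" for g :: "'i \<Rightarrow> complex"
    using sum.reindex_bij_betw[OF h, of g] by (simp add: atLeast0LessThan)
  have powA: "(A ^\<^sub>m k) $$ (i, j) = mpow S M k (h i) (h j)" if "i < n" "j < n" for i j k
    using that
  proof (induction k arbitrary: i j)
    case 0
    then show ?case using A h by (auto simp: bij_betw_def inj_on_def)
  next
    case (Suc k)
    have "(A ^\<^sub>m Suc k) $$ (i, j) = (\<Sum>l<n. (A ^\<^sub>m k) $$ (i, l) * A $$ (l, j))"
      using Suc.prems A by (auto simp: scalar_prod_def atLeast0LessThan)
    also have "\<dots> = (\<Sum>l<n. mpow S M k (h i) (h l) * M (h l) (h j))"
      using Suc by (intro sum.cong refl) (auto simp: A_def)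
    also have "\<dots> = mpow S M (Suc k) (h i) (h j)"
      using Suc.prems by (simp only: mpow_Suc_right[OF assms hS hS] sumh)
    finally show ?case .
  qed
  obtain B where B: "B \<in> carrier_mat n n" "upper_triangular B" "similar_mat A B"
    using char_poly_factorized[OF A] schur_decomposition_exists[OF A] by blast
  obtain P Q where wit: "similar_mat_wit A B P Q" using B(3) unfolding similar_mat_def by blast
  note PQ = similar_mat_witD2[OF A wit]
  have tr: "(\<Sum>i<n. (A ^\<^sub>m k) $$ (i, i)) = (\<Sum>i<n. (B $$ (i, i)) ^ k)" for k
  proof -
    have Bk: "B ^\<^sub>m k \<in> carrier_mat n n" using B(1) by simp
    have "(\<Sum>i<n. (A ^\<^sub>m k) $$ (i, i)) = (\<Sum>i<n. (P * (B ^\<^sub>m k * Q)) $$ (i, i))"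
      unfolding similar_mat_wit_pow_id[OF wit] assoc_mult_mat[OF PQ(6) Bk PQ(7)] ..
    \<comment> \<open>Cyclicity of the trace brings \<open>Q\<close> next to \<open>P\<close>, where
      they cancel.\<close>
    also have "\<dots> = (\<Sum>i<n. ((B ^\<^sub>m k * Q) * P) $$ (i, i))"
      using PQ Bk by (intro sum_diag_mult_mat_commute) auto
    also have "(B ^\<^sub>m k * Q) * P = B ^\<^sub>m k"
      using PQ(2) Bk unfolding assoc_mult_mat[OF Bk PQ(7,6)] by (simp add: right_mult_one_mat[OF Bk])
    also have "(\<Sum>i<n. (B ^\<^sub>m k) $$ (i, i)) = (\<Sum>i<n. (B $$ (i, i)) ^ k)"
      using upper_triangular_pow[OF B(1,2)] by (intro sum.cong refl) simp
    finally show ?thesis .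
  qed
  show ?thesis
  proof (rule that[of "diag_mat B"])
    show "det_on S M = prod_list (diag_mat B)"
      using detA det_similar[OF B(3)] det_upper_triangular[OF B(2,1)] by simp
    fix k
    have "trace_pow S M k = (\<Sum>i<n. (A ^\<^sub>m k) $$ (i, i))"
      unfolding trace_pow_def sumh using powA by simp
    also have "\<dots> = (\<Sum>e\<leftarrow>diag_mat B. e ^ k)"
      unfolding tr using B(1) by (simp add: diag_mat_def interv_sum_list_conv_sum_set_nat atLeast0LessThan comp_def)
    finally show "trace_pow S M k = (\<Sum>e\<leftarrow>diag_mat B. e ^ k)" .
  qed
qed

section \<open>Power sums and multisets of eigenvalues\<close>

text \<open>The sum of a polynomial over a list is a combination of power sums, hence the same for
  both lists; a polynomial vanishing at all entries other than \<open>z\<close> isolates the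
  multiplicity of \<open>z\<close>. The exponent 0 is included, with \<open>0 ^ 0 = 1\<close>, so
  zeros are counted as well.\<close>

lemma mset_eq_if_power_sums_eq:
  fixes xs ys :: "'a::field_char_0 list"
  assumes "\<And>k. (\<Sum>e\<leftarrow>xs. e ^ k) = (\<Sum>e\<leftarrow>ys. e ^ k)"
  shows "mset xs = mset ys"
proof (rule multiset_eqI)
  fix z
  define X where "X = insert z (set xs \<union> set ys)"
  have fin: "finite X" by (simp add: X_def)
  have poly_sum: "(\<Sum>e\<leftarrow>zs. poly p e) = (\<Sum>k\<le>degree p. coeff p k * (\<Sum>e\<leftarrow>zs. e ^ k))"
    for p and zs :: "'a list"
  proof (induction zs)
    case (Cons a zs)
    then show ?case by (simp add: poly_altdef[of p a] sum.distrib distrib_left)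
  qed simp
  have eq: "(\<Sum>e\<leftarrow>xs. poly p e) = (\<Sum>e\<leftarrow>ys. poly p e)" for p
    unfolding poly_sum assms ..
  define p where "p = (\<Prod>u\<in>X - {z}. [:- u, 1:])"
  have count: "(\<Sum>e\<leftarrow>zs. poly p e) = of_nat (count (mset zs) z) * poly p z"
    if "set zs \<subseteq> X" for zs
    using that
  proof (induction zs)
    case (Cons a zs)
    then have "a \<noteq> z \<Longrightarrow> poly p a = 0"
      using fin by (auto simp: p_def poly_prod)
    then show ?case using Cons by (auto simp: distrib_right)
  qed simp
  have "poly p z \<noteq> 0" using fin by (auto simp: p_def poly_prod)
  then show "count (mset xs) z = count (mset ys) z"
    using eq[of p] count[of xs] count[of ys] by (simp add: X_def subset_iff)
qed

text \<open>The right side of \<open>tr\<close> is the power sum of the eigenvalues of all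
  \<open>N w\<close>, each taken \<open>m w\<close> times. Equal power sums give equal multisets,
  hence equal products.\<close>

lemma det_on_eq_prod_if_trace_pow_eq:
  fixes M :: "'i \<Rightarrow> 'i \<Rightarrow> complex" and N :: "'w \<Rightarrow> 'j \<Rightarrow> 'j \<Rightarrow> complex"
  assumes "finite S" "finite I" "\<And>w. w \<in> I \<Longrightarrow> finite (T w)"
    and tr: "\<And>k. trace_pow S M k = (\<Sum>w\<in>I. of_nat (m w) * trace_pow (T w) (N w) k)"
  shows "det_on S M = (\<Prod>w\<in>I. det_on (T w) (N w) ^ m w)"
proof -
  obtain es where es: "det_on S M = prod_list es" "\<And>k. trace_pow S M k = (\<Sum>e\<leftarrow>es. e ^ k)"
    using det_trace_pow_eigenvalues[OF assms(1)] by blast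
  have "\<forall>w\<in>I. \<exists>fs. det_on (T w) (N w) = prod_list fs \<and>
      (\<forall>k. trace_pow (T w) (N w) k = (\<Sum>e\<leftarrow>fs. e ^ k))"
    using det_trace_pow_eigenvalues[OF assms(3)] by metis
  then obtain fs where fs: "\<And>w. w \<in> I \<Longrightarrow> det_on (T w) (N w) = prod_list (fs w)"
    "\<And>w k. w \<in> I \<Longrightarrow> trace_pow (T w) (N w) k = (\<Sum>e\<leftarrow>fs w. e ^ k)"
    by metis
  obtain ws where ws: "set ws = I" "distinct ws"
    using finite_distinct_list[OF assms(2)] by blast
  define gs where "gs = concat (map (\<lambda>w. concat (replicate (m w) (fs w))) ws)"
  have rep: "(\<Sum>e\<leftarrow>concat (replicate n l). e ^ k) = of_nat n * (\<Sum>e\<leftarrow>l. e ^ k)"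
    "prod_list (concat (replicate n l)) = prod_list l ^ n" for n k and l :: "complex list"
    by (induction n) (simp_all add: distrib_right)
  have "(\<Sum>e\<leftarrow>gs. e ^ k) = (\<Sum>w\<leftarrow>ws. of_nat (m w) * (\<Sum>e\<leftarrow>fs w. e ^ k))" for k
    unfolding gs_def by (induction ws) (simp_all add: rep)
  also have "(\<Sum>w\<leftarrow>ws. of_nat (m w) * (\<Sum>e\<leftarrow>fs w. e ^ k)) = (\<Sum>e\<leftarrow>es. e ^ k)" for k
    using ws tr[of k] es(2) fs(2) by (simp add: sum_list_distinct_conv_sum_set)
  finally have "mset gs = mset es"
    by (rule mset_eq_if_power_sums_eq)
  then have "prod_list es = prod_list gs"
    by (metis prod_mset_prod_list)
  also have "\<dots> = (\<Prod>w\<leftarrow>ws. prod_list (fs w) ^ m w)"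
    unfolding gs_def by (induction ws) (simp_all add: rep)
  also have "\<dots> = (\<Prod>w\<in>I. prod_list (fs w) ^ m w)"
    using ws by (simp add: prod.distinct_set_conv_list[symmetric])
  finally show ?thesis using es(1) fs(1) by simp
qed

section \<open>Transfer of polynomial identities from the complex numbers to commutative rings\<close>

text \<open>\<open>polyrel I f g\<close>: there is one polynomial with integer coefficients in the
  indeterminates \<open>I\<close> whose polynomial functions over the two rings are \<open>f\<close> and \<open>g\<close>.\<close>
inductive polyrel :: "'i set \<Rightarrow> (('i \<Rightarrow> 'a::comm_ring_1) \<Rightarrow> 'a) \<Rightarrow>
    (('i \<Rightarrow> 'r::comm_ring_1) \<Rightarrow> 'r) \<Rightarrow> bool" for I where
  var: "i \<in> I \<Longrightarrow> polyrel I (\<lambda>\<rho>. \<rho> i) (\<lambda>\<rho>. \<rho> i)"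
| const: "polyrel I (\<lambda>_. of_int c) (\<lambda>_. of_int c)"
| add: "polyrel I f g \<Longrightarrow> polyrel I f' g' \<Longrightarrow> polyrel I (\<lambda>\<rho>. f \<rho> + f' \<rho>) (\<lambda>\<rho>. g \<rho> + g' \<rho>)"
| mult: "polyrel I f g \<Longrightarrow> polyrel I f' g' \<Longrightarrow> polyrel I (\<lambda>\<rho>. f \<rho> * f' \<rho>) (\<lambda>\<rho>. g \<rho> * g' \<rho>)"

lemma polyrel_0: "polyrel I (\<lambda>_. 0) (\<lambda>_. 0)"
  and polyrel_1: "polyrel I (\<lambda>_. 1) (\<lambda>_. 1)"
  using polyrel.const[of I 0] polyrel.const[of I 1] by simp_all

lemma polyrel_uminus: "polyrel I f g \<Longrightarrow> polyrel I (\<lambda>\<rho>. - f \<rho>) (\<lambda>\<rho>. - g \<rho>)"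
  using polyrel.mult[OF polyrel.const[of I "-1"], of f g] by simp

lemma polyrel_sum:
  "(\<And>s. s \<in> S \<Longrightarrow> polyrel I (f s) (g s)) \<Longrightarrow> polyrel I (\<lambda>\<rho>. \<Sum>s\<in>S. f s \<rho>) (\<lambda>\<rho>. \<Sum>s\<in>S. g s \<rho>)"
  by (induction S rule: infinite_finite_induct) (auto intro: polyrel_0 polyrel.add)

lemma polyrel_prod:
  "(\<And>s. s \<in> S \<Longrightarrow> polyrel I (f s) (g s)) \<Longrightarrow> polyrel I (\<lambda>\<rho>. \<Prod>s\<in>S. f s \<rho>) (\<lambda>\<rho>. \<Prod>s\<in>S. g s \<rho>)"
  by (induction S rule: infinite_finite_induct) (auto intro: polyrel_1 polyrel.mult)

lemma polyrel_power: "polyrel I f g \<Longrightarrow> polyrel I (\<lambda>\<rho>. f \<rho> ^ n) (\<lambda>\<rho>. g \<rho> ^ n)"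
  by (induction n) (auto intro: polyrel_1 polyrel.mult)

lemma polyrel_det_on:
  assumes "\<And>i j. i \<in> S \<Longrightarrow> j \<in> S \<Longrightarrow> polyrel I (\<lambda>\<rho>. M \<rho> i j) (\<lambda>\<rho>. N \<rho> i j)"
  shows "polyrel I (\<lambda>\<rho>. det_on S (M \<rho>)) (\<lambda>\<rho>. det_on S (N \<rho>))"
  unfolding det_on_def using assms
  by (intro polyrel_sum polyrel.mult polyrel.const polyrel_prod) (auto simp: permutes_in_image)

lemma polyrel_cong_on:
  assumes "polyrel I f g" "\<And>i. i \<in> I \<Longrightarrow> \<rho> i = \<rho>' i"
  shows "f \<rho> = f \<rho>'"
  using assms by (induction rule: polyrel.induct) auto

text \<open>Collects powers of the indeterminate \<open>i\<close>; the coefficients are polynomials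
  in the remaining ones.\<close>

lemma polyrel_insertE:
  fixes f :: "('i \<Rightarrow> 'a::comm_ring_1) \<Rightarrow> 'a" and g :: "('i \<Rightarrow> 'r::comm_ring_1) \<Rightarrow> 'r"
  assumes "polyrel (insert i I) f g"
  obtains p q where "\<And>\<rho>. f \<rho> = poly (p \<rho>) (\<rho> i)" "\<And>\<rho>. g \<rho> = poly (q \<rho>) (\<rho> i)"
    "\<And>k. polyrel I (\<lambda>\<rho>. coeff (p \<rho>) k) (\<lambda>\<rho>. coeff (q \<rho>) k)"
proof -
  have "\<exists>p q. (\<forall>\<rho>. f \<rho> = poly (p \<rho>) (\<rho> i)) \<and> (\<forall>\<rho>. g \<rho> = poly (q \<rho>) (\<rho> i)) \<and>
    (\<forall>k. polyrel I (\<lambda>\<rho>. coeff (p \<rho>) k) (\<lambda>\<rho>. coeff (q \<rho>) k))"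
    using assms
  proof (induction rule: polyrel.induct)
    case (var j)
    show ?case
    proof (cases "j = i")
      case True
      have "polyrel I (\<lambda>_. coeff [:0, 1 :: 'a:] k) (\<lambda>_. coeff [:0, 1 :: 'r:] k)" for k
        by (auto simp: coeff_pCons intro: polyrel_0 polyrel_1 split: nat.split)
      with True show ?thesis
        by (intro exI[of _ "\<lambda>_. [:0, 1:]"]) simp
    next
      case False
      with var have "j \<in> I" by simp
      then have "polyrel I (\<lambda>\<rho>. coeff [:\<rho> j :: 'a:] k) (\<lambda>\<rho>. coeff [:\<rho> j :: 'r:] k)" for k
        by (cases k) (auto intro: polyrel_0 polyrel.var)
      then show ?thesis
        by (intro exI[of _ "\<lambda>\<rho>. [:\<rho> j:]"]) simp
    qed
  next
    case (const c)
    have "polyrel I (\<lambda>_. coeff [:of_int c :: 'a:] k) (\<lambda>_. coeff [:of_int c :: 'r:] k)" for k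
      by (auto simp: coeff_pCons intro: polyrel_0 polyrel.const split: nat.split)
    then show ?case
      by (intro exI[of _ "\<lambda>_. [:of_int c:]"]) simp
  next
    case (add f g f' g')
    then obtain p q p' q' where
      "\<forall>\<rho>. f \<rho> = poly (p \<rho>) (\<rho> i)" "\<forall>\<rho>. g \<rho> = poly (q \<rho>) (\<rho> i)"
      "\<forall>k. polyrel I (\<lambda>\<rho>. coeff (p \<rho>) k) (\<lambda>\<rho>. coeff (q \<rho>) k)"
      "\<forall>\<rho>. f' \<rho> = poly (p' \<rho>) (\<rho> i)" "\<forall>\<rho>. g' \<rho> = poly (q' \<rho>) (\<rho> i)"
      "\<forall>k. polyrel I (\<lambda>\<rho>. coeff (p' \<rho>) k) (\<lambda>\<rho>. coeff (q' \<rho>) k)"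
      by blast
    then show ?case
      by (intro exI[of _ "\<lambda>\<rho>. p \<rho> + p' \<rho>"] exI[of _ "\<lambda>\<rho>. q \<rho> + q' \<rho>"])
        (auto intro: polyrel.add)
  next
    case (mult f g f' g')
    then obtain p q p' q' where
      "\<forall>\<rho>. f \<rho> = poly (p \<rho>) (\<rho> i)" "\<forall>\<rho>. g \<rho> = poly (q \<rho>) (\<rho> i)"
      "\<forall>k. polyrel I (\<lambda>\<rho>. coeff (p \<rho>) k) (\<lambda>\<rho>. coeff (q \<rho>) k)"
      "\<forall>\<rho>. f' \<rho> = poly (p' \<rho>) (\<rho> i)" "\<forall>\<rho>. g' \<rho> = poly (q' \<rho>) (\<rho> i)"
      "\<forall>k. polyrel I (\<lambda>\<rho>. coeff (p' \<rho>) k) (\<lambda>\<rho>. coeff (q' \<rho>) k)"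
      by blast
    then show ?case
      by (intro exI[of _ "\<lambda>\<rho>. p \<rho> * p' \<rho>"] exI[of _ "\<lambda>\<rho>. q \<rho> * q' \<rho>"])
        (auto simp: coeff_mult intro!: polyrel_sum polyrel.mult)
  qed
  then show ?thesis using that by blast
qed

text \<open>Induction on the indeterminates: as a polynomial in one of them, \<open>f\<close>
  vanishes at infinitely many points, so its coefficients vanish identically, and by induction so do
  the corresponding coefficients of \<open>g\<close>. With no indeterminate left, \<open>f\<close>
  is the image of an integer, which characteristic 0 forces to be 0.\<close>

lemma polyrel_eq_0_transfer:
  fixes f :: "('i \<Rightarrow> 'a::{idom,ring_char_0}) \<Rightarrow> 'a"
  assumes "finite I" "polyrel I f g" "\<And>\<rho>. f \<rho> = 0"
  shows "g \<rho> = 0"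
  using assms
proof (induction I arbitrary: f g \<rho> rule: finite_induct)
  case empty
  from empty(1) have "\<exists>c. (\<forall>\<rho>. f \<rho> = of_int c) \<and> (\<forall>\<rho>. g \<rho> = of_int c)"
  proof (induction rule: polyrel.induct)
    case (add f g f' g')
    then show ?case by (metis of_int_add)
  next
    case (mult f g f' g')
    then show ?case by (metis of_int_mult)
  qed auto
  then show ?case using empty(2) by (metis of_int_eq_0_iff of_int_0)
next
  case (insert i I)
  obtain p q where pq: "\<And>\<rho>. f \<rho> = poly (p \<rho>) (\<rho> i)" "\<And>\<rho>. g \<rho> = poly (q \<rho>) (\<rho> i)"
    "\<And>k. polyrel I (\<lambda>\<rho>. coeff (p \<rho>) k) (\<lambda>\<rho>. coeff (q \<rho>) k)"
    using polyrel_insertE[OF insert.prems(1)] by blast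
  have "p \<rho> = 0" for \<rho>
  proof -
    have "poly (p \<rho>) t = 0" for t
    proof -
      \<comment> \<open>The coefficients do not involve the indeterminate \<open>i\<close>, so its
        value can vary while the polynomial stays fixed.\<close>
      have "p (\<rho>(i := t)) = p \<rho>"
        by (rule poly_eqI, rule polyrel_cong_on[OF pq(3)]) (use insert.hyps in auto)
      then show ?thesis
        using insert.prems(2)[of "\<rho>(i := t)"] pq(1)[of "\<rho>(i := t)"]
        by (simp del: fun_upd_apply add: fun_upd_same)
    qed
    then show ?thesis using poly_all_0_iff_0 by blast
  qed
  then have "coeff (q \<rho>) k = 0" for k
    using insert.IH[OF pq(3)] by simp
  then have "q \<rho> = 0" by (simp add: poly_eq_iff)
  then show ?case by (simp add: pq(2))
qed

lemma polyrel_eq_transfer: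
  fixes f f' :: "('i \<Rightarrow> 'a::{idom,ring_char_0}) \<Rightarrow> 'a"
  assumes "finite I" "polyrel I f g" "polyrel I f' g'" "\<And>\<rho>. f \<rho> = f' \<rho>"
  shows "g \<rho> = g' \<rho>"
  using polyrel_eq_0_transfer[OF assms(1) polyrel.add[OF assms(2) polyrel_uminus[OF assms(3)]], of \<rho>]
    assms(4) by simp

section \<open>The exploration algorithm\<close>

text \<open>The algorithm is run with an arbitrary set \<open>D\<close> of accepted edges in place of a tree.\<close>
definition explore_state ::
    "('v \<times> 'v) set \<Rightarrow> ('v \<times> 'v) set \<Rightarrow> 'v::linorder \<Rightarrow> nat \<Rightarrow> 'v set \<times> ('v \<times> 'v) list \<times> ('v \<times> 'v) set" where
  "explore_state E D w n = (explore_step D ^^ n) (explore_init E w)"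

definition examined_before :: "('v \<times> 'v) set \<Rightarrow> ('v \<times> 'v) set \<Rightarrow> 'v::linorder \<Rightarrow> nat \<Rightarrow> ('v \<times> 'v) set" where
  "examined_before E D w n = {e. \<exists>m<n. \<exists>A L F. explore_state E D w m = (A, e # L, F)}"

definition examined :: "('v \<times> 'v) set \<Rightarrow> ('v \<times> 'v) set \<Rightarrow> 'v::linorder \<Rightarrow> ('v \<times> 'v) set" where
  "examined E D w = (\<Union>n. examined_before E D w n)"

text \<open>The final accepted set, by \<open>while_explore\<close>, expressed by the examined edges
  and the choice of the accepted ones among them.\<close>

definition explored :: "('v \<times> 'v) set \<Rightarrow> ('v \<times> 'v) set \<Rightarrow> 'v::linorder \<Rightarrow> 'v set" where
  "explored E D w = insert w (fst ` (examined E D w \<inter> D))"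

lemma explore_state_Suc: "explore_state E D w (Suc n) = explore_step D (explore_state E D w n)"
  by (simp add: explore_state_def)

lemma examined_before_Suc:
  "examined_before E D w (Suc n) = examined_before E D w n \<union>
     {e. \<exists>A L F. explore_state E D w n = (A, e # L, F)}"
  by (auto simp: examined_before_def less_Suc_eq)

text \<open>The accepted and the erased vertices determine \<open>F\<close> and the elements of \<open>L\<close>.\<close>
lemma explore_state_invariant:
  fixes E D :: "('v::linorder \<times> 'v) set"
  assumes "finite E" "\<forall>v. (v, v) \<notin> E"
    and "explore_state E D w n = (A, L, F)" "P = examined_before E D w n" "R = fst ` (P - D)"
  shows "A = insert w (fst ` (P \<inter> D)) \<and> P \<subseteq> E \<and> snd ` P \<subseteq> A \<and> inj_on fst P \<and> w \<notin> fst ` P \<and>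
    F = {d\<in>E. fst d \<notin> A \<and> fst d \<notin> R \<and> snd d \<notin> R} \<and> set L = {d\<in>F. snd d \<in> A} \<and>
    (\<forall>u\<in>A. (u, w) \<in> (P \<inter> D)\<^sup>*)"
  using assms(3-)
proof (induction n arbitrary: A L F P R)
  case 0
  have "finite {u. (u, w) \<in> E}"
    using finite_imageI[OF assms(1), of fst] by (rule finite_subset[rotated]) force
  then have "set (sorted_list_of_set {u. (u, w) \<in> E}) = {u. (u, w) \<in> E}" by simp
  with 0 assms(2) show ?case
    by (force simp: explore_state_def explore_init_def examined_before_def)
next
  case (Suc n)
  obtain A0 L0 F0 where st: "explore_state E D w n = (A0, L0, F0)"
    by (cases "explore_state E D w n") auto
  define P0 where "P0 = examined_before E D w n"
  define R0 where "R0 = fst ` (P0 - D)"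
  have inv: "A0 = insert w (fst ` (P0 \<inter> D))" "P0 \<subseteq> E" "snd ` P0 \<subseteq> A0" "inj_on fst P0" "w \<notin> fst ` P0"
    "F0 = {d\<in>E. fst d \<notin> A0 \<and> fst d \<notin> R0 \<and> snd d \<notin> R0}" "set L0 = {d\<in>F0. snd d \<in> A0}"
    "\<And>u. u \<in> A0 \<Longrightarrow> (u, w) \<in> (P0 \<inter> D)\<^sup>*"
    using Suc.IH[OF st P0_def R0_def] by blast+
  show ?case
  proof (cases L0)
    case Nil
    \<comment> \<open>A finished exploration repeats its state, so the invariant holds for every
      \<open>n\<close>.\<close>
    then have "A = A0" "L = L0" "F = F0" "P = P0"
      using Suc.prems st by (auto simp: explore_state_Suc explore_step_def examined_before_Suc P0_def)
    moreover from this have "R = R0" using Suc.prems(3) R0_def by simp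
    ultimately show ?thesis using Suc.IH[OF st P0_def R0_def] by iprover
  next
    case (Cons e L1)
    have P: "P = insert e P0"
      using Suc.prems(2) st Cons by (auto simp: examined_before_Suc P0_def)
    have e: "e \<in> E" "fst e \<notin> A0" "fst e \<notin> R0" "snd e \<notin> R0" "snd e \<in> A0"
      using inv(6,7) Cons by auto
    \<comment> \<open>The head of the list lies in \<open>F0\<close>, so its source has been neither
      accepted nor erased: no vertex is the source of two examined edges.\<close>
    have fe: "fst e \<notin> fst ` P0" using e inv(1) R0_def by auto
    have inj: "inj_on fst P" using inv(4) fe by (auto simp: P)
    show ?thesis
    proof (cases "e \<in> D")
      case True
      define F1 where "F1 = {d \<in> F0. fst d \<noteq> fst e}"
      have "finite F0" using assms(1) inv(6) by simp
      then have "finite {u. (u, fst e) \<in> F0 \<and> u \<noteq> fst e}"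
        using finite_imageI[of F0 fst] by (rule_tac finite_subset[of _ "fst ` F0"]) force
      then have sl: "set (sorted_list_of_set {u. (u, fst e) \<in> F0 \<and> u \<noteq> fst e}) =
          {u. (u, fst e) \<in> F0 \<and> u \<noteq> fst e}" by simp
      have step: "(A, L, F) = (insert (fst e) A0, filter (\<lambda>d. fst d \<noteq> fst e) L0 @
          map (\<lambda>u. (u, fst e)) (sorted_list_of_set {u. (u, fst e) \<in> F0 \<and> u \<noteq> fst e}), F1)"
        using Suc.prems(1) st Cons True
        by (simp add: explore_state_Suc explore_step_def Let_def F1_def)
      have A: "A = insert (fst e) A0" and F: "F = F1" using step by simp_all
      have "set L = {d\<in>set L0. fst d \<noteq> fst e} \<union>
          (\<lambda>u. (u, fst e)) ` {u. (u, fst e) \<in> F0 \<and> u \<noteq> fst e}"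
        using step sl by simp
      also have "(\<lambda>u. (u, fst e)) ` {u. (u, fst e) \<in> F0 \<and> u \<noteq> fst e} = {d\<in>F1. snd d = fst e}"
        by (force simp: F1_def)
      finally have L: "set L = {d\<in>set L0. fst d \<noteq> fst e} \<union> {d\<in>F1. snd d = fst e}" .
      have R: "R = R0" using Suc.prems(3) True by (auto simp: P R0_def)
      have "(u, w) \<in> (P \<inter> D)\<^sup>*" if "u \<in> A" for u
      proof -
        have *: "(u, w) \<in> (P \<inter> D)\<^sup>*" if "u \<in> A0" for u
          using inv(8)[OF that] rtrancl_mono[of "P0 \<inter> D" "P \<inter> D"] P by blast
        \<comment> \<open>The accepted edge leads into \<open>A0\<close>, from which accepted edges
          already lead to \<open>w\<close>.\<close>
        have "(fst e, snd e) \<in> P \<inter> D" using True P by simp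
        then have "(fst e, w) \<in> (P \<inter> D)\<^sup>*"
          using *[OF e(5)] by (rule converse_rtrancl_into_rtrancl)
        then show ?thesis using that * A by auto
      qed
      moreover have "F = {d\<in>E. fst d \<notin> A \<and> fst d \<notin> R \<and> snd d \<notin> R}"
        unfolding F F1_def inv(6) A R by auto
      moreover have "set L = {d\<in>F. snd d \<in> A}"
        unfolding L F F1_def inv(7) A by auto
      moreover have "A = insert w (fst ` (P \<inter> D))" using A inv(1) P True by auto
      moreover have "P \<subseteq> E" "snd ` P \<subseteq> A" "w \<notin> fst ` P"
        using inv(1,2,3,5) e P A by auto
      ultimately show ?thesis
        using inj by blast
    next
      case False
      have A: "A = A0" and F: "F = {d\<in>F0. fst d \<noteq> fst e \<and> snd d \<noteq> fst e}"
        and L: "set L = {d\<in>set L0. fst d \<noteq> fst e \<and> snd d \<noteq> fst e}"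
        using Suc.prems(1) st Cons False by (simp_all add: explore_state_Suc explore_step_def Let_def) auto
      have R: "R = insert (fst e) R0" and PD: "P \<inter> D = P0 \<inter> D"
        using Suc.prems(3) False by (auto simp: P R0_def)
      have "F = {d\<in>E. fst d \<notin> A \<and> fst d \<notin> R \<and> snd d \<notin> R}"
        unfolding F inv(6) A R by auto
      moreover have "set L = {d\<in>F. snd d \<in> A}"
        unfolding L F inv(7) A by auto
      moreover have "w \<notin> fst ` P" using inv(1,5) e(2) P by auto
      moreover have "A = insert w (fst ` (P \<inter> D))" using A inv(1) PD by simp
      moreover have "P \<subseteq> E" "snd ` P \<subseteq> A"
        using inv(2,3) e P A by auto
      moreover have "(u, w) \<in> (P \<inter> D)\<^sup>*" if "u \<in> A" for u
        using inv(8) that PD A by simp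
      ultimately show ?thesis
        using inj by blast
    qed
  qed
qed

text \<open>Every step examines a new edge, so the list empties after at most \<open>card E\<close>
  steps.\<close>

lemma explore_terminates:
  fixes E D :: "('v::linorder \<times> 'v) set"
  assumes "finite E" "\<forall>v. (v, v) \<notin> E"
  obtains N A F where "explore_state E D w N = (A, [], F)"
    "while (\<lambda>(A, L, F). L \<noteq> []) (explore_step D) (explore_init E w) = (A, [], F)"
proof -
  let ?L = "\<lambda>n. fst (snd (explore_state E D w n))"
  have "\<exists>N. ?L N = []"
  proof (rule ccontr)
    assume "\<nexists>N. ?L N = []"
    then have ne: "?L n \<noteq> []" for n by blast
    have "card (examined_before E D w n) = n \<and> examined_before E D w n \<subseteq> E" for n
    proof (induction n)
      case 0
      then show ?case by (simp add: examined_before_def)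
    next
      case (Suc n)
      obtain A L F where st: "explore_state E D w n = (A, L, F)"
        by (cases "explore_state E D w n") auto
      then obtain e L' where L: "L = e # L'" using ne[of n] by (cases L) auto
      note inv = explore_state_invariant[OF assms st refl refl]
      have P: "examined_before E D w (Suc n) = insert e (examined_before E D w n)"
        using st L by (auto simp: examined_before_Suc)
      have "e \<in> set L" using L by simp
      then have "e \<in> E \<and> e \<notin> examined_before E D w n" using inv by auto
      then show ?case
        using Suc P by (simp add: card_insert_disjoint finite_subset[OF _ assms(1)])
    qed
    then have "Suc (card E) \<le> card E"
      using card_mono[OF assms(1)] by metis
    then show False by simp
  qed
  define N where "N = (LEAST N. ?L N = [])"
  have N: "?L N = []" "\<And>m. m < N \<Longrightarrow> ?L m \<noteq> []"
    unfolding N_def using \<open>\<exists>N. ?L N = []\<close> by (auto intro: LeastI_ex dest: not_less_Least)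
  obtain A F where st: "explore_state E D w N = (A, [], F)"
    using N(1) by (cases "explore_state E D w N") auto
  \<comment> \<open>Backward induction from the terminal state to the initial one.\<close>
  have "while (\<lambda>(A, L, F). L \<noteq> []) (explore_step D) (explore_state E D w n) = (A, [], F)"
    if "n \<le> N" for n
    using that
  proof (induction "N - n" arbitrary: n)
    case 0
    then show ?case using st by (simp add: while_unfold)
  next
    case (Suc k)
    then have "?L n \<noteq> []" using N(2)[of n] by simp
    then show ?case
      using Suc by (subst while_unfold) (simp add: case_prod_beta explore_state_Suc[symmetric])
  qed
  from this[of 0] have "while (\<lambda>(A, L, F). L \<noteq> []) (explore_step D) (explore_init E w) = (A, [], F)"
    by (simp add: explore_state_def)
  then show ?thesis using that st by blast
qed

text \<open>The state no longer changes once the list is empty.\<close>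

lemma examined_eq_examined_before:
  assumes "explore_state E D w N = (A, [], F)"
  shows "examined E D w = examined_before E D w N"
proof -
  have "explore_state E D w (N + k) = (A, [], F)" for k
    by (induction k) (simp_all add: assms explore_state_Suc explore_step_def)
  then have "explore_state E D w m = (A, [], F)" if "N \<le> m" for m
    using that by (metis le_add_diff_inverse)
  then have "m < N" if "explore_state E D w m = (A', e # L', F')" for m A' e L' F'
    using that by (metis list.distinct(1) not_less prod.inject)
  then show ?thesis
    unfolding examined_def examined_before_def by blast
qed

text \<open>The invariant read in the terminal state. In particular, emptiness of the list means
  that every edge into the explored set starts at an explored or an erased vertex.\<close>

lemma
  fixes E D :: "('v::linorder \<times> 'v) set"
  assumes "finite E" "\<forall>v. (v, v) \<notin> E"
  shows while_explore: "fst (while (\<lambda>(A, L, F). L \<noteq> []) (explore_step D) (explore_init E w)) = explored E D w"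
    and examined_subset: "examined E D w \<subseteq> E"
    and inj_on_fst_examined: "inj_on fst (examined E D w)"
    and root_notin_fst_examined: "w \<notin> fst ` examined E D w"
    and explored_reaches_root: "u \<in> explored E D w \<Longrightarrow> (u, w) \<in> (examined E D w \<inter> D)\<^sup>*"
    and explored_closed: "d \<in> E \<Longrightarrow> snd d \<in> explored E D w \<Longrightarrow>
      fst d \<in> explored E D w \<or> fst d \<in> fst ` (examined E D w - D)"
proof -
  obtain N A F where st: "explore_state E D w N = (A, [], F)"
    and wh: "while (\<lambda>(A, L, F). L \<noteq> []) (explore_step D) (explore_init E w) = (A, [], F)"
    using explore_terminates[OF assms] by blast
  note P = examined_eq_examined_before[OF st]
  note inv = explore_state_invariant[OF assms st P refl]
  show P_props: "examined E D w \<subseteq> E" "inj_on fst (examined E D w)" "w \<notin> fst ` examined E D w"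
    using inv by simp_all
  have A: "A = explored E D w" unfolding explored_def using inv by simp
  have F: "F = {d\<in>E. fst d \<notin> A \<and> fst d \<notin> fst ` (examined E D w - D) \<and>
      snd d \<notin> fst ` (examined E D w - D)}" and "set [] = {d\<in>F. snd d \<in> A}"
    using inv by iprover+
  then have L: "{d\<in>F. snd d \<in> A} = {}" by simp
  show "fst (while (\<lambda>(A, L, F). L \<noteq> []) (explore_step D) (explore_init E w)) = explored E D w"
    using wh A by simp
  have "\<forall>u\<in>A. (u, w) \<in> (examined E D w \<inter> D)\<^sup>*" using inv by iprover
  then show "u \<in> explored E D w \<Longrightarrow> (u, w) \<in> (examined E D w \<inter> D)\<^sup>*"
    unfolding A by auto
  \<comment> \<open>A vertex is the source of at most one examined edge, so accepted vertices are
    never erased; an edge into the explored set is thus missing from \<open>F\<close> only because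
    of its source.\<close>
  have "fst ` (examined E D w \<inter> D) \<inter> fst ` (examined E D w - D) = {}"
    using inj_on_image_Int[OF P_props(2), of "examined E D w \<inter> D" "examined E D w - D"] by auto
  then have "A \<inter> fst ` (examined E D w - D) = {}"
    unfolding A explored_def using P_props(3) by blast
  then show "d \<in> E \<Longrightarrow> snd d \<in> explored E D w \<Longrightarrow>
      fst d \<in> explored E D w \<or> fst d \<in> fst ` (examined E D w - D)"
    using F L unfolding A by blast
qed

text \<open>The algorithm consults \<open>D\<close> only about the edge at the head of the
  list.\<close>

lemma explore_cong:
  assumes "\<And>e. e \<in> examined E D w \<Longrightarrow> e \<in> D \<longleftrightarrow> e \<in> D'"
  shows "examined E D' w = examined E D w" "explored E D' w = explored E D w"
proof -
  have "explore_state E D' w n = explore_state E D w n" for n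
  proof (induction n)
    case 0
    then show ?case by (simp add: explore_state_def)
  next
    case (Suc n)
    obtain A L F where st: "explore_state E D w n = (A, L, F)"
      by (cases "explore_state E D w n") auto
    show ?case
    proof (cases L)
      case Nil
      then show ?thesis using st Suc by (simp add: explore_state_Suc explore_step_def)
    next
      case (Cons e L')
      then have "e \<in> examined E D w"
        using st lessI[of n] unfolding examined_def examined_before_def by blast
      then show ?thesis
        using st Suc Cons assms by (simp add: explore_state_Suc explore_step_def)
    qed
  qed
  then show *: "examined E D' w = examined E D w"
    by (simp add: examined_def examined_before_def)
  show "explored E D' w = explored E D w"
    using assms unfolding explored_def * by blast
qed

section \<open>Spanning trees and forests\<close>

definition forests :: "'v set \<Rightarrow> ('v \<times> 'v) set \<Rightarrow> 'v set \<Rightarrow> ('v \<times> 'v) set set" where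
  "forests V E U = {F. F \<subseteq> E \<and> acyclic F \<and> (\<forall>e\<in>F. fst e \<notin> U) \<and>
     (\<forall>v\<in>V - U. \<exists>!e. e \<in> F \<and> fst e = v)}"

lemma forest_edges_eqI:
  assumes "F \<in> forests V E U" "E \<subseteq> V \<times> V" "d \<in> F" "e \<in> F" "fst d = fst e"
  shows "d = e"
  using assms unfolding forests_def by (smt (verit) DiffI mem_Collect_eq mem_Sigma_iff prod.collapse subsetD)

lemma spanning_tree_rooted_iff:
  "spanning_tree_rooted V E T r \<longleftrightarrow> r \<in> V \<and> T \<in> forests V E {r}"
  by (auto simp: spanning_tree_rooted_def forests_def)

text \<open>On a cycle through \<open>u\<close>, uniqueness of outgoing edges makes every vertex
  reachable from \<open>u\<close> lead back to \<open>u\<close>. But the root is reachable and has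
  no outgoing edge.\<close>

lemma acyclic_if_all_reach:
  assumes functional: "\<And>d e. d \<in> T \<Longrightarrow> e \<in> T \<Longrightarrow> fst d = fst e \<Longrightarrow> d = e"
    and root: "\<And>e. e \<in> T \<Longrightarrow> fst e \<noteq> r"
    and reach: "\<And>e. e \<in> T \<Longrightarrow> (fst e, r) \<in> T\<^sup>*"
  shows "acyclic T"
proof (rule acyclicI, safe)
  fix u assume u: "(u, u) \<in> T\<^sup>+"
  have "(z, u) \<in> T\<^sup>+" if "(u, z) \<in> T\<^sup>*" for z
    using that
  proof (induction rule: rtrancl_induct)
    case (step z z')
    from tranclD[OF step.IH] obtain z'' where "(z, z'') \<in> T" "(z'', u) \<in> T\<^sup>*" by blast
    moreover from this have "z'' = z'" using functional[of "(z, z')" "(z, z'')"] step by simp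
    ultimately show ?case using u by simp
  qed (rule u)
  moreover have "(u, r) \<in> T\<^sup>*" using tranclD[OF u] reach by force
  ultimately have "(r, u) \<in> T\<^sup>+" by blast
  from tranclD[OF this] show False using root by force
qed

locale loopless_digraph =
  fixes V :: "'v::linorder set" and E :: "('v \<times> 'v) set"
  assumes finite_V: "finite V" and E_subset: "E \<subseteq> V \<times> V" and loopless: "\<forall>v. (v, v) \<notin> E"
begin

abbreviation trees :: "'v \<Rightarrow> ('v \<times> 'v) set set" where
  "trees r \<equiv> {T. spanning_tree_rooted V E T r}"

lemma finite_E: "finite E"
  using finite_subset[OF E_subset] finite_V by simp

lemma finite_trees: "finite (trees r)"
  by (rule finite_subset[of _ "Pow E"]) (auto simp: spanning_tree_rooted_def finite_E)

lemma spanning_tree_root_unique: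
  assumes "spanning_tree_rooted V E T r" "spanning_tree_rooted V E T r'"
  shows "r = r'"
  using assms unfolding spanning_tree_rooted_def by (metis DiffI singletonD)

lemma tree_root_eq:
  assumes "spanning_tree_rooted V E T r"
  shows "tree_root V E T = r"
  unfolding tree_root_def using assms spanning_tree_root_unique by blast

lemma tree_edges_eqI:
  assumes "spanning_tree_rooted V E T r" "d \<in> T" "e \<in> T" "fst d = fst e"
  shows "d = e"
  using forest_edges_eqI[OF _ E_subset assms(2-4)] assms(1) unfolding spanning_tree_rooted_iff by blast

lemma forest_if_tree:
  assumes "spanning_tree_rooted V E T r" "r \<in> U"
  shows "{e\<in>T. fst e \<notin> U} \<in> forests V E U"
proof -
  have "acyclic {e\<in>T. fst e \<notin> U}"
    using assms(1) by (auto simp: spanning_tree_rooted_def intro: acyclic_subset)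
  moreover have "\<exists>!e. e \<in> {e\<in>T. fst e \<notin> U} \<and> fst e = v" if "v \<in> V - U" for v
  proof -
    have "v \<in> V - {r}" using that assms(2) by auto
    then have "\<exists>!e. e \<in> T \<and> fst e = v" using assms(1) by (simp add: spanning_tree_rooted_def)
    moreover have "(e \<in> {e\<in>T. fst e \<notin> U} \<and> fst e = v) = (e \<in> T \<and> fst e = v)" for e
      using that by auto
    ultimately show ?thesis by simp
  qed
  ultimately show ?thesis
    using assms(1) by (auto simp: forests_def spanning_tree_rooted_def)
qed

text \<open>A path can be continued as long as it is outside \<open>U\<close>, and in a finite
  acyclic set it must end.\<close>

lemma forest_reaches:
  assumes "F \<in> forests V E U" "v \<in> V"
  shows "\<exists>u\<in>U. (v, u) \<in> F\<^sup>*"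
proof -
  have F: "F \<subseteq> E" "acyclic F" "\<And>v. v \<in> V - U \<Longrightarrow> \<exists>e. e \<in> F \<and> fst e = v"
    using assms(1) unfolding forests_def by blast+
  have "wf (F\<inverse>)"
    using finite_subset[OF F(1) finite_E] F(2) by (rule finite_acyclic_wf_converse)
  then show ?thesis using assms(2)
  proof (induction v rule: wf_induct_rule)
    case (less v)
    show ?case
    proof (cases "v \<in> U")
      case False
      then obtain v' where v': "(v, v') \<in> F" using F(3)[of v] less.prems by force
      then have "v' \<in> V" using F(1) E_subset by auto
      then obtain u where "u \<in> U" "(v', u) \<in> F\<^sup>*" using less.IH[of v'] v' by blast
      then show ?thesis using v' converse_rtrancl_into_rtrancl by metis
    qed auto
  qed
qed

text \<open>Accepted edges with source outside \<open>U\<close> belong to \<open>F\<close>, and each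
  vertex of \<open>U\<close> other than \<open>w\<close> has exactly one accepted edge going out.
  Edges of \<open>F\<close> lead every vertex to \<open>U\<close>, and accepted edges lead on to
  \<open>w\<close>, so there is no cycle.\<close>

lemma tree_if_explored:
  assumes F: "F \<in> forests V E U" and U: "w \<in> U" "U \<subseteq> V"
    and D: "D = F \<union> {e\<in>E. fst e \<in> U}" and cover: "U \<subseteq> explored E D w"
    and T: "T = F \<union> (examined E D w \<inter> D)"
  shows "spanning_tree_rooted V E T w"
proof -
  note ex = examined_subset[OF finite_E loopless, of D w]
    inj_on_fst_examined[OF finite_E loopless, of D w]
    root_notin_fst_examined[OF finite_E loopless, of w D]
  have F': "F \<subseteq> E" "\<And>e. e \<in> F \<Longrightarrow> fst e \<notin> U" "\<And>v. v \<in> V - U \<Longrightarrow> \<exists>e. e \<in> F \<and> fst e = v"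
    using F unfolding forests_def by blast+
  have in_F: "e \<in> F" if "e \<in> T" "fst e \<notin> U" for e
    using that T D by auto
  have in_ex: "e \<in> examined E D w" if "e \<in> T" "fst e \<in> U" for e
    using that T F'(2)[of e] by auto
  have functional: "d = e" if "d \<in> T" "e \<in> T" "fst d = fst e" for d e
  proof (cases "fst d \<in> U")
    case True
    then show ?thesis using that in_ex ex(2) by (metis inj_onD)
  next
    case False
    then show ?thesis using that in_F forest_edges_eqI[OF F E_subset] by metis
  qed
  have root: "fst e \<noteq> w" if "e \<in> T" for e
    using that T F'(2)[of e] U ex(3) by auto
  have T_E: "T \<subseteq> E" using T F'(1) ex(1) by auto
  have reach: "(v, w) \<in> T\<^sup>*" if v: "v \<in> V" for v
  proof -
    obtain u where u: "u \<in> U" "(v, u) \<in> F\<^sup>*" using forest_reaches[OF F v] by blast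
    have "(u, w) \<in> (examined E D w \<inter> D)\<^sup>*"
      using explored_reaches_root[OF finite_E loopless] u cover by blast
    then have "(u, w) \<in> T\<^sup>*" "(v, u) \<in> T\<^sup>*"
      using u(2) rtrancl_mono[of "examined E D w \<inter> D" T] rtrancl_mono[of F T] T by blast+
    then show ?thesis by simp
  qed
  have "acyclic T"
    using functional root reach T_E E_subset by (intro acyclic_if_all_reach[of T w]) force+
  moreover have "\<exists>!e. e \<in> T \<and> fst e = v" if v: "v \<in> V - {w}" for v
  proof -
    have "\<exists>e. e \<in> T \<and> fst e = v"
    proof (cases "v \<in> U")
      case True
      then have "v \<in> fst ` (examined E D w \<inter> D)" using cover v by (auto simp: explored_def)
      then show ?thesis using T by auto
    next
      case False
      then show ?thesis using F'(3)[of v] v T by auto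
    qed
    then show ?thesis using functional by blast
  qed
  ultimately show ?thesis
    using T_E root U by (auto simp: spanning_tree_rooted_def)
qed

text \<open>Induction backwards along a path inside \<open>U\<close> to \<open>w\<close>: a vertex
  with an edge into the explored set is explored or erased, and erasing a vertex of \<open>U\<close>
  would need a rejected edge out of it.\<close>

lemma strongly_connected_set_explored:
  assumes U: "strongly_connected_set V E U" "w \<in> U" and D: "\<And>e. e \<in> E \<Longrightarrow> fst e \<in> U \<Longrightarrow> e \<in> D"
  shows "U \<subseteq> explored E D w"
proof
  fix u assume "u \<in> U"
  then have "(u, w) \<in> (E \<inter> (U \<times> U))\<^sup>*"
    using U by (simp add: strongly_connected_set_def)
  then show "u \<in> explored E D w"
  proof (induction rule: converse_rtrancl_induct)
    case base
    then show ?case by (simp add: explored_def)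
  next
    case (step u z)
    have "e \<in> D" if "e \<in> examined E D w" "fst e = u" for e
      using that D step.hyps examined_subset[OF finite_E loopless] by blast
    then have "u \<notin> fst ` (examined E D w - D)" by auto
    then show ?case
      using explored_closed[OF finite_E loopless, of "(u, z)" D w] step by auto
  qed
qed

text \<open>Inverse map: run the exploration accepting every edge that starts in \<open>U\<close>, and add the edges
  accepted from \<open>U\<close> to the forest.\<close>
lemma bij_betw_explored_trees_forests:
  assumes U: "strongly_connected_set V E U" "w \<in> U"
  shows "bij_betw (\<lambda>a. {e\<in>a. fst e \<notin> U}) {a \<in> trees w. U \<subseteq> explored E a w} (forests V E U)"
proof -
  define D where "D F = F \<union> {e\<in>E. fst e \<in> U}" for F
  note ex = examined_subset[OF finite_E loopless] inj_on_fst_examined[OF finite_E loopless]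
    root_notin_fst_examined[OF finite_E loopless]
  have UV: "U \<subseteq> V" using U by (simp add: strongly_connected_set_def)
  \<comment> \<open>The source of an examined edge out of \<open>U\<close> is explored and is
    examined only once, so \<open>a\<close> accepts the edge, as does \<open>D\<close>. Thus the
    exploration depends only on the edges of \<open>a\<close> with source outside
    \<open>U\<close>.\<close>
  have run: "examined E (D {e\<in>a. fst e \<notin> U}) w = examined E a w"
    if a: "U \<subseteq> explored E a w" for a
  proof (rule explore_cong)
    fix e assume e: "e \<in> examined E a w"
    show "e \<in> a \<longleftrightarrow> e \<in> D {e\<in>a. fst e \<notin> U}"
    proof (cases "fst e \<in> U")
      case True
      then have "fst e \<in> fst ` (examined E a w \<inter> a)"
        using a e ex(3)[of w a] by (auto simp: explored_def)
      then have "e \<in> a" using e ex(2)[of a w] by (auto simp: inj_on_def)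
      then show ?thesis using True e ex(1) by (auto simp: D_def)
    qed (auto simp: D_def)
  qed
  \<comment> \<open>The only tree edge out of a vertex of \<open>U\<close> is the one through which
    that vertex was accepted.\<close>
  have edge: "e \<in> examined E a w"
    if a: "spanning_tree_rooted V E a w" "U \<subseteq> explored E a w" and e: "e \<in> a" "fst e \<in> U" for a e
  proof -
    have "fst e \<noteq> w" using a e by (auto simp: spanning_tree_rooted_def)
    then obtain d where "d \<in> examined E a w" "d \<in> a" "fst d = fst e"
      using a e by (auto simp: explored_def)
    then show ?thesis using tree_edges_eqI[OF a(1)] e by metis
  qed
  \<comment> \<open>By \<open>run\<close>, trees with the same restriction have the same examined
    edges, at most one out of each vertex.\<close>
  have le: "a \<subseteq> b" if a: "spanning_tree_rooted V E a w" "U \<subseteq> explored E a w"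
    and b: "spanning_tree_rooted V E b w" "U \<subseteq> explored E b w"
    and eq: "{e\<in>a. fst e \<notin> U} = {e\<in>b. fst e \<notin> U}" for a b
  proof
    fix e assume e: "e \<in> a"
    show "e \<in> b"
    proof (cases "fst e \<in> U")
      case True
      have "fst e \<in> V - {w}" using True UV a e by (auto simp: spanning_tree_rooted_def)
      then obtain d where d: "d \<in> b" "fst d = fst e"
        using b unfolding spanning_tree_rooted_def by metis
      have "d \<in> examined E b w" using edge[OF b d(1)] d True by simp
      moreover have "e \<in> examined E b w"
        using edge[OF a e True] run[OF a(2)] run[OF b(2)] eq by simp
      ultimately have "e = d" using d ex(2)[of b w] by (auto simp: inj_on_def)
      then show ?thesis using d by simp
    qed (use e eq in auto)
  qed
  have surj: "\<exists>a. spanning_tree_rooted V E a w \<and> U \<subseteq> explored E a w \<and> {e\<in>a. fst e \<notin> U} = F"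
    if F: "F \<in> forests V E U" for F
  proof -
    define a where "a = F \<union> (examined E (D F) w \<inter> D F)"
    have cover: "U \<subseteq> explored E (D F) w"
      by (rule strongly_connected_set_explored[OF U]) (auto simp: D_def)
    have tree: "spanning_tree_rooted V E a w"
      by (rule tree_if_explored[OF F U(2) UV _ cover a_def]) (simp add: D_def)
    have restr: "{e\<in>a. fst e \<notin> U} = F"
      using F by (auto simp: a_def D_def forests_def)
    \<comment> \<open>\<open>a\<close> and \<open>D F\<close> agree on the edges examined under
      \<open>D F\<close>.\<close>
    have "explored E a w = explored E (D F) w"
      by (rule explore_cong) (use F in \<open>auto simp: a_def D_def\<close>)
    then show ?thesis using tree restr cover by auto
  qed
  show ?thesis
    unfolding bij_betw_def
  proof
    show "inj_on (\<lambda>a. {e\<in>a. fst e \<notin> U}) {a \<in> trees w. U \<subseteq> explored E a w}"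
      by (rule inj_onI, rule subset_antisym) (auto dest: le[THEN subsetD])
    show "(\<lambda>a. {e\<in>a. fst e \<notin> U}) ` {a \<in> trees w. U \<subseteq> explored E a w} = forests V E U"
      using surj forest_if_tree[OF _ U(2)] by (auto simp: image_iff)
  qed
qed

section \<open>Multiplicities\<close>

lemma explore_phi_eq:
  assumes "spanning_tree_rooted V E a w"
  shows "explore_phi V E a = explored E a w"
  by (simp add: explore_phi_def tree_root_eq[OF assms] while_explore[OF finite_E loopless])

lemma explore_psi_eq:
  assumes "spanning_tree_rooted V E a w" "A = explored E a w"
  shows "explore_psi V E a = {u\<in>A. (w, u) \<in> (E \<inter> (A \<times> A))\<^sup>* \<and> (u, w) \<in> (E \<inter> (A \<times> A))\<^sup>*}"
  by (simp add: explore_psi_def Let_def explore_phi_eq[OF assms(1)] tree_root_eq[OF assms(1)] assms(2))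

lemma explored_subset_V:
  assumes "w \<in> V"
  shows "explored E D w \<subseteq> V"
  using assms examined_subset[OF finite_E loopless, of D w] E_subset by (auto simp: explored_def)

text \<open>A path inside the explored set between two vertices of the component of \<open>w\<close>
  stays within that component.\<close>

lemma strongly_connected_explore_psi:
  assumes a: "spanning_tree_rooted V E a w"
  shows "strongly_connected_set V E (explore_psi V E a)" "w \<in> explore_psi V E a"
proof -
  define A where "A = explored E a w"
  define W where "W = explore_psi V E a"
  note W = explore_psi_eq[OF a A_def, folded W_def]
  have wV: "w \<in> V" using a by (simp add: spanning_tree_rooted_def)
  have "w \<in> A" by (simp add: A_def explored_def)
  then show w: "w \<in> explore_psi V E a" unfolding W_def[symmetric] W by simp
  have "(u, z) \<in> (E \<inter> (W \<times> W))\<^sup>*" if u: "u \<in> W" and z: "z \<in> W" for u z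
  proof -
    have "(u, w) \<in> (E \<inter> (A \<times> A))\<^sup>*" "(w, z) \<in> (E \<inter> (A \<times> A))\<^sup>*"
      using u z unfolding W by auto
    then have "(u, z) \<in> (E \<inter> (A \<times> A))\<^sup>*" by (rule rtrancl_trans)
    then show ?thesis using u
    proof (induction rule: converse_rtrancl_induct)
      case (step u u')
      have "(u', w) \<in> (E \<inter> (A \<times> A))\<^sup>*"
        using step.hyps(2) z unfolding W by (auto intro: rtrancl_trans)
      moreover have "(w, u') \<in> (E \<inter> (A \<times> A))\<^sup>*"
        using step.hyps(1) step.prems unfolding W by (auto intro: rtrancl_into_rtrancl)
      ultimately have "u' \<in> W" using step.hyps(1) unfolding W by blast
      then have "(u, u') \<in> E \<inter> (W \<times> W)" "(u', z) \<in> (E \<inter> (W \<times> W))\<^sup>*" using step by auto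
      then show ?case by (rule converse_rtrancl_into_rtrancl)
    qed simp
  qed
  moreover have "W \<subseteq> V" using explored_subset_V[OF wV, of a] unfolding W A_def by blast
  ultimately show "strongly_connected_set V E (explore_psi V E a)"
    using w unfolding strongly_connected_set_def W_def by blast
qed

text \<open>Paths inside \<open>U\<close> are paths inside the explored set, which puts
  \<open>U\<close> into the component of \<open>w\<close>.\<close>

lemma subset_explore_psi_iff:
  assumes "spanning_tree_rooted V E a w" "strongly_connected_set V E U" "w \<in> U"
  shows "U \<subseteq> explore_psi V E a \<longleftrightarrow> U \<subseteq> explored E a w"
proof
  assume sub: "U \<subseteq> explored E a w"
  define A where "A = explored E a w"
  have "(E \<inter> (U \<times> U))\<^sup>* \<subseteq> (E \<inter> (A \<times> A))\<^sup>*"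
    using sub unfolding A_def by (intro rtrancl_mono) auto
  then show "U \<subseteq> explore_psi V E a"
    using assms(2,3) sub unfolding explore_psi_eq[OF assms(1) A_def] strongly_connected_set_def A_def
    by blast
qed (auto simp: explore_psi_eq[OF assms(1) refl])

lemma finite_strongly_connected_sets: "finite {W. strongly_connected_set V E W \<and> P W}"
  by (rule finite_subset[of _ "Pow V"]) (auto simp: strongly_connected_set_def finite_V)

text \<open>The trees whose exploration covers \<open>U\<close> are sorted by their value of
  \<open>explore_psi\<close>, a strongly connected set; their total is known from the bijection with
  forests.\<close>

lemma sum_tree_mult:
  assumes U: "strongly_connected_set V E U" "w \<in> U"
  shows "(\<Sum>W | strongly_connected_set V E W \<and> U \<subseteq> W. tree_mult V E W w) = card (forests V E U)"
proof -
  have "{a \<in> trees w. U \<subseteq> explored E a w} =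
      (\<Union>W\<in>{W. strongly_connected_set V E W \<and> U \<subseteq> W}. {a \<in> trees w. explore_psi V E a = W})"
    using subset_explore_psi_iff[OF _ U] strongly_connected_explore_psi(1) by auto
  then have "card {a \<in> trees w. U \<subseteq> explored E a w} =
      (\<Sum>W | strongly_connected_set V E W \<and> U \<subseteq> W. card {a \<in> trees w. explore_psi V E a = W})"
    by (simp only:) (intro card_UN_disjoint finite_strongly_connected_sets, auto intro: finite_subset[OF _ finite_trees])
  then show ?thesis
    using bij_betw_same_card[OF bij_betw_explored_trees_forests[OF U]] by (simp add: tree_mult_def)
qed

text \<open>The forest count in \<open>sum_tree_mult\<close> does not mention the vertex.
  Subtracting the terms of the strictly larger sets, which agree by induction from large sets to
  small, leaves the term of \<open>W\<close>.\<close>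

lemma tree_mult_independent:
  assumes "strongly_connected_set V E W" "w1 \<in> W" "w2 \<in> W"
  shows "tree_mult V E W w1 = tree_mult V E W w2"
  using assms
proof (induction "card V - card W" arbitrary: W rule: less_induct)
  case less
  let ?S = "{W'. strongly_connected_set V E W' \<and> W \<subset> W'}"
  have eq: "card (forests V E W) = tree_mult V E W w + (\<Sum>W'\<in>?S. tree_mult V E W' w)"
    if "w \<in> W" for w
  proof -
    have "{W'. strongly_connected_set V E W' \<and> W \<subseteq> W'} = insert W ?S" using less.prems by auto
    then show ?thesis
      using sum_tree_mult[OF less.prems(1) that] finite_strongly_connected_sets[of "\<lambda>W'. W \<subset> W'"] by simp
  qed
  have "(\<Sum>W'\<in>?S. tree_mult V E W' w1) = (\<Sum>W'\<in>?S. tree_mult V E W' w2)"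
  proof (intro sum.cong refl)
    fix W' assume W': "W' \<in> ?S"
    then have "W' \<subseteq> V" by (simp add: strongly_connected_set_def)
    then have "card W < card W'" "card W' \<le> card V"
      using W' finite_V by (auto intro: psubset_card_mono card_mono finite_subset)
    then have "card V - card W' < card V - card W" by simp
    then show "tree_mult V E W' w1 = tree_mult V E W' w2"
      using less.hyps[of W'] W' less.prems by blast
  qed
  then show ?case using eq[OF less.prems(2)] eq[OF less.prems(3)] by simp
qed

end

section \<open>Walks\<close>

text \<open>The starting vertex is kept apart: for \<open>\<gamma>\<close> in
  \<open>walks S k\<close>, the list \<open>v # \<gamma>\<close> makes \<open>k\<close>
  steps.\<close>

definition walks :: "'i set \<Rightarrow> nat \<Rightarrow> 'i list set" where
  "walks S k = {\<gamma>. set \<gamma> \<subseteq> S \<and> length \<gamma> = k}"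

fun walk_weight :: "('i \<Rightarrow> 'i \<Rightarrow> 'r::comm_ring_1) \<Rightarrow> 'i list \<Rightarrow> 'r" where
  "walk_weight M (v # w # \<gamma>) = M v w * walk_weight M (w # \<gamma>)"
| "walk_weight M _ = 1"

text \<open>Lifts a walk of the root to trees. A stationary step corresponds to a diagonal entry and
  leaves the tree unchanged.\<close>

fun tree_walk :: "('v \<times> 'v) set \<Rightarrow> 'v list \<Rightarrow> ('v \<times> 'v) set" where
  "tree_walk a (v # w # \<gamma>) = tree_walk (if v = w then a else tree_move a (v, w)) (w # \<gamma>)"
| "tree_walk a _ = a"

lemma finite_walks: "finite S \<Longrightarrow> finite (walks S k)"
  unfolding walks_def by (rule finite_lists_length_eq)

lemma walks_0: "walks S 0 = {[]}"
  by (auto simp: walks_def)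

lemma sum_walks_Suc: "(\<Sum>\<gamma>\<in>walks S (Suc k). g \<gamma>) = (\<Sum>v\<in>S. \<Sum>\<gamma>\<in>walks S k. g (v # \<gamma>))"
proof -
  have "walks S (Suc k) = (\<lambda>(v, \<gamma>). v # \<gamma>) ` (S \<times> walks S k)"
    by (auto simp: walks_def length_Suc_conv image_iff)
  then have "(\<Sum>\<gamma>\<in>walks S (Suc k). g \<gamma>) = (\<Sum>(v, \<gamma>)\<in>S \<times> walks S k. g (v # \<gamma>))"
    by (simp add: sum.reindex inj_on_def case_prod_beta)
  then show ?thesis by (simp add: sum.cartesian_product)
qed

lemma mpow_eq_sum_walks:
  assumes "finite S"
  shows "mpow S M k i j = (\<Sum>\<gamma>\<in>walks S k. if last (i # \<gamma>) = j then walk_weight M (i # \<gamma>) else 0)"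
proof (induction k arbitrary: i)
  case 0
  then show ?case by (simp add: walks_0)
next
  case (Suc k)
  have "mpow S M (Suc k) i j =
      (\<Sum>l\<in>S. \<Sum>\<gamma>\<in>walks S k. M i l * (if last (l # \<gamma>) = j then walk_weight M (l # \<gamma>) else 0))"
    unfolding mpow.simps(2) Suc.IH sum_distrib_left ..
  also have "\<dots> = (\<Sum>l\<in>S. \<Sum>\<gamma>\<in>walks S k.
      if last (i # l # \<gamma>) = j then walk_weight M (i # l # \<gamma>) else 0)"
    by (intro sum.cong refl) simp
  finally show ?case unfolding sum_walks_Suc .
qed

text \<open>Summing over the walks in all of \<open>S\<close> gives the same range for every
  \<open>W\<close>, so that traces can be compared walk by walk.\<close>

lemma trace_pow_eq_sum_walks:
  assumes "finite S" "W \<subseteq> S"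
  shows "trace_pow W M k = (\<Sum>v\<in>S. \<Sum>\<gamma>\<in>walks S k.
    if last (v # \<gamma>) = v \<and> set (v # \<gamma>) \<subseteq> W then walk_weight M (v # \<gamma>) else 0)"
proof -
  let ?g = "\<lambda>v \<gamma>. if last (v # \<gamma>) = v \<and> set (v # \<gamma>) \<subseteq> W then walk_weight M (v # \<gamma>) else 0"
  have fin: "finite W" using assms finite_subset by blast
  have "trace_pow W M k = (\<Sum>v\<in>W. \<Sum>\<gamma>\<in>walks W k. ?g v \<gamma>)"
    unfolding trace_pow_def mpow_eq_sum_walks[OF fin]
    by (intro sum.cong refl) (auto simp: walks_def)
  also have "\<dots> = (\<Sum>v\<in>W. \<Sum>\<gamma>\<in>walks S k. ?g v \<gamma>)"
    using assms by (intro sum.cong refl sum.mono_neutral_left finite_walks) (auto simp: walks_def)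
  also have "\<dots> = (\<Sum>v\<in>S. \<Sum>\<gamma>\<in>walks S k. ?g v \<gamma>)"
    using assms by (intro sum.mono_neutral_left) auto
  finally show ?thesis .
qed

text \<open>A move along \<open>(v, w)\<close> touches only edges out of \<open>v\<close> and
  \<open>w\<close>.\<close>

lemma tree_walk_outside:
  assumes "set \<gamma> \<subseteq> U"
  shows "{d \<in> tree_walk a \<gamma>. fst d \<notin> U} = {d \<in> a. fst d \<notin> U}"
  using assms
proof (induction a \<gamma> rule: tree_walk.induct)
  case (1 a v w \<gamma>)
  then show ?case by (auto simp: tree_move_def)
qed auto

text \<open>Arriving at a vertex deletes its outgoing edges, so what the two sets had there is
  forgotten and only the last exits of the walk remain. At the starting vertex there is nothing to
  delete.\<close>

lemma tree_walk_determined: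
  assumes "{d \<in> a. fst d \<notin> set (v # \<gamma>)} = {d \<in> b. fst d \<notin> set (v # \<gamma>)}"
    and "\<forall>d\<in>a. fst d \<noteq> v" "\<forall>d\<in>b. fst d \<noteq> v"
  shows "tree_walk a (v # \<gamma>) = tree_walk b (v # \<gamma>)"
  using assms
proof (induction \<gamma> arbitrary: a b v)
  case Nil
  then show ?case by auto
next
  case (Cons w \<gamma>)
  show ?case
  proof (cases "v = w")
    case True
    then show ?thesis using Cons.prems Cons.IH[of a w b] by simp
  next
    case False
    have "tree_walk (tree_move a (v, w)) (w # \<gamma>) = tree_walk (tree_move b (v, w)) (w # \<gamma>)"
    proof (rule Cons.IH)
      \<comment> \<open>If the walk does not return to \<open>v\<close>, the sets still agree there,
        as neither has an edge out of \<open>v\<close>.\<close>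
      have "d \<in> a \<longleftrightarrow> d \<in> b" if "fst d \<notin> set (w # \<gamma>)" for d
        using that Cons.prems by (cases "fst d = v") auto
      then show "{d \<in> tree_move a (v, w). fst d \<notin> set (w # \<gamma>)} =
          {d \<in> tree_move b (v, w). fst d \<notin> set (w # \<gamma>)}"
        by (auto simp: tree_move_def)
    qed (use False in \<open>auto simp: tree_move_def\<close>)
    then show ?thesis using False by simp
  qed
qed

lemma walk_reachable:
  assumes "successively (\<lambda>u w. u = w \<or> (u, w) \<in> E) (v # \<gamma>)" "set (v # \<gamma>) \<subseteq> U" "u \<in> set (v # \<gamma>)"
  shows "(v, u) \<in> (E \<inter> (U \<times> U))\<^sup>* \<and> (u, last (v # \<gamma>)) \<in> (E \<inter> (U \<times> U))\<^sup>*"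
  using assms
proof (induction \<gamma> arbitrary: v u)
  case Nil
  then show ?case by simp
next
  case (Cons w \<gamma>)
  have vw: "(v, w) \<in> (E \<inter> (U \<times> U))\<^sup>*" using Cons.prems by auto
  have IH: "(w, z) \<in> (E \<inter> (U \<times> U))\<^sup>* \<and> (z, last (w # \<gamma>)) \<in> (E \<inter> (U \<times> U))\<^sup>*" if "z \<in> set (w # \<gamma>)" for z
    using Cons.IH[of w z] Cons.prems that by simp
  show ?case
  proof (cases "u \<in> set (w # \<gamma>)")
    case True
    then show ?thesis using IH[OF True] vw by (auto intro: rtrancl_trans)
  next
    case False
    then have "u = v" using Cons.prems by simp
    then show ?thesis using IH[of w] vw by (auto intro: rtrancl_trans)
  qed
qed

section \<open>Trees fixed by closed walks\<close>

context loopless_digraph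
begin

lemma tree_move_rooted:
  assumes a: "spanning_tree_rooted V E a v" and e: "(v, w) \<in> E"
  shows "spanning_tree_rooted V E (tree_move a (v, w)) w"
proof -
  have vw: "v \<noteq> w" "v \<in> V" "w \<in> V" using e loopless E_subset by auto
  have a': "a \<subseteq> E" "acyclic a" "\<forall>d\<in>a. fst d \<noteq> v" "\<forall>u\<in>V - {v}. \<exists>!d. d \<in> a \<and> fst d = u"
    using a by (auto simp: spanning_tree_rooted_def)
  let ?R = "{d\<in>a. fst d \<noteq> w}"
  \<comment> \<open>With its outgoing edge deleted, \<open>w\<close> reaches only itself, so the new
    edge into \<open>w\<close> closes no cycle.\<close>
  have "(w, v) \<notin> ?R\<^sup>*"
    using vw(1) by (auto elim: converse_rtranclE)
  moreover have "acyclic ?R" using a'(2) by (rule acyclic_subset) auto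
  ultimately have "acyclic (tree_move a (v, w))"
    by (simp add: tree_move_def)
  moreover have "\<exists>!d. d \<in> tree_move a (v, w) \<and> fst d = u" if u: "u \<in> V - {w}" for u
  proof (cases "u = v")
    case True
    then show ?thesis using a'(3) by (intro ex1I[of _ "(v, w)"]) (auto simp: tree_move_def)
  next
    case False
    then have "d \<in> tree_move a (v, w) \<and> fst d = u \<longleftrightarrow> d \<in> a \<and> fst d = u" for d
      using u by (auto simp: tree_move_def)
    then show ?thesis using a'(4) u False by simp
  qed
  moreover have "tree_move a (v, w) \<subseteq> E" "\<forall>d\<in>tree_move a (v, w). fst d \<noteq> w"
    using a' e vw by (auto simp: tree_move_def)
  ultimately show ?thesis using vw unfolding spanning_tree_rooted_def by blast
qed

lemma tree_walk_rooted:
  assumes "spanning_tree_rooted V E a v" "successively (\<lambda>u w. u = w \<or> (u, w) \<in> E) (v # \<gamma>)"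
  shows "spanning_tree_rooted V E (tree_walk a (v # \<gamma>)) (last (v # \<gamma>))"
  using assms
proof (induction \<gamma> arbitrary: a v)
  case Nil
  then show ?case by simp
next
  case (Cons w \<gamma>)
  have "spanning_tree_rooted V E (if v = w then a else tree_move a (v, w)) w"
    using Cons.prems tree_move_rooted by auto
  then show ?case using Cons by simp
qed

text \<open>On trees rooted at \<open>v\<close>, the walk keeps the edges with source outside
  \<open>U\<close>, and its result depends on nothing else. Hence each restriction belongs to
  exactly one fixed tree: the result of the walk on any tree with that restriction.\<close>

lemma bij_betw_closed_walk_trees_forests:
  assumes walk: "successively (\<lambda>u w. u = w \<or> (u, w) \<in> E) (v # \<gamma>)" "last (v # \<gamma>) = v"
    and U: "U = set (v # \<gamma>)" "U \<subseteq> V"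
  shows "bij_betw (\<lambda>a. {e\<in>a. fst e \<notin> U}) {a \<in> trees v. tree_walk a (v # \<gamma>) = a} (forests V E U)"
    and "strongly_connected_set V E U"
proof -
  have vU: "v \<in> U" using U by simp
  have "(u, w) \<in> (E \<inter> (U \<times> U))\<^sup>*" if "u \<in> U" "w \<in> U" for u w
    using walk_reachable[OF walk(1), of U u] walk_reachable[OF walk(1), of U w] that walk(2) U
    by (auto intro: rtrancl_trans)
  then show sc: "strongly_connected_set V E U"
    using U vU by (auto simp: strongly_connected_set_def)
  have no_out: "\<forall>d\<in>a. fst d \<noteq> v" if "a \<in> trees v" for a
    using that by (simp add: spanning_tree_rooted_def)
  have det: "tree_walk a (v # \<gamma>) = tree_walk b (v # \<gamma>)"
    if "a \<in> trees v" "b \<in> trees v" "{e\<in>a. fst e \<notin> U} = {e\<in>b. fst e \<notin> U}" for a b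
    using tree_walk_determined[of a v \<gamma> b] that no_out U by simp
  have "\<exists>a. a \<in> trees v \<and> tree_walk a (v # \<gamma>) = a \<and> {e\<in>a. fst e \<notin> U} = F"
    if F: "F \<in> forests V E U" for F
  proof -
    \<comment> \<open>Strong connectivity of \<open>U\<close> lets the exploration bijection supply
      a tree that extends \<open>F\<close>.\<close>
    have "F \<in> (\<lambda>a. {e\<in>a. fst e \<notin> U}) ` {a \<in> trees v. U \<subseteq> explored E a v}"
      using bij_betw_imp_surj_on[OF bij_betw_explored_trees_forests[OF sc vU]] F by simp
    then obtain b where b: "b \<in> trees v" "{e\<in>b. fst e \<notin> U} = F" by auto
    define a where "a = tree_walk b (v # \<gamma>)"
    have "a \<in> trees v" using tree_walk_rooted[OF _ walk(1)] b(1) walk(2) by (simp add: a_def)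
    moreover have "{e\<in>a. fst e \<notin> U} = F"
      using tree_walk_outside[of "v # \<gamma>" U b] U b(2) by (simp add: a_def)
    \<comment> \<open>\<open>a\<close> and \<open>b\<close> have the same restriction, so the walk
      takes both to the same tree, namely \<open>a\<close>.\<close>
    ultimately show ?thesis using det[of a b] b by (auto simp: a_def)
  qed
  moreover have "inj_on (\<lambda>a. {e\<in>a. fst e \<notin> U}) {a \<in> trees v. tree_walk a (v # \<gamma>) = a}"
  proof (rule inj_onI)
    fix a b
    assume "a \<in> {a \<in> trees v. tree_walk a (v # \<gamma>) = a}" "b \<in> {a \<in> trees v. tree_walk a (v # \<gamma>) = a}"
      "{e\<in>a. fst e \<notin> U} = {e\<in>b. fst e \<notin> U}"
    then show "a = b" using det[of a b] by simp
  qed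
  ultimately show "bij_betw (\<lambda>a. {e\<in>a. fst e \<notin> U}) {a \<in> trees v. tree_walk a (v # \<gamma>) = a} (forests V E U)"
    using forest_if_tree[OF _ vU] unfolding bij_betw_def by (auto simp: image_iff)
qed

section \<open>Traces of powers of the lifted operator\<close>

lemma successively_if_walk_weight_nonzero:
  assumes "walk_weight (schroedinger E x y) \<gamma> \<noteq> 0"
  shows "successively (\<lambda>u w. u = w \<or> (u, w) \<in> E) \<gamma>"
  using assms
proof (induction \<gamma> rule: induct_list012)
  case (3 u w \<gamma>)
  then have "schroedinger E x y u w \<noteq> 0" "walk_weight (schroedinger E x y) (w # \<gamma>) \<noteq> 0" by auto
  moreover from this(1) have "u = w \<or> (u, w) \<in> E" by (auto simp: schroedinger_def split: if_splits)
  ultimately show ?case using 3 by simp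
qed auto

text \<open>A row of the lifted operator is a row of the Schroedinger operator distributed over the
  trees reached; \<open>w = r\<close> gives the diagonal entry.\<close>

lemma lifted_schroedinger_eq_sum:
  assumes a: "spanning_tree_rooted V E a r"
  shows "lifted_schroedinger V E x y a c =
    (\<Sum>w\<in>V. if (if r = w then a else tree_move a (r, w)) = c then schroedinger E x y r w else 0)"
    (is "_ = (\<Sum>w\<in>V. ?f w)")
proof (cases "a = c")
  case True
  have rV: "r \<in> V" and no_out: "\<forall>d\<in>a. fst d \<noteq> r" using a by (auto simp: spanning_tree_rooted_def)
  \<comment> \<open>A move adds an edge out of \<open>r\<close>, which \<open>a\<close> lacks, so it
    never gives back \<open>a\<close>.\<close>
  have "(r, w) \<in> tree_move a (r, w)" for w by (simp add: tree_move_def)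
  then have "tree_move a (r, w) \<noteq> a" for w using no_out by (metis fst_conv)
  then have "?f w = (if r = w then schroedinger E x y r r else 0)" for w
    using True by auto
  then have "(\<Sum>w\<in>V. ?f w) = schroedinger E x y r r"
    using rV finite_V by simp
  then show ?thesis
    using True tree_root_eq[OF a] by (simp add: lifted_schroedinger_def schroedinger_def)
next
  case False
  have "{e\<in>E. fst e = r \<and> tree_move a e = c} = Pair r ` {w\<in>V. (r, w) \<in> E \<and> tree_move a (r, w) = c}"
    using E_subset by (auto simp: image_iff)
  then have "lifted_schroedinger V E x y a c =
      (\<Sum>w | w \<in> V \<and> (r, w) \<in> E \<and> tree_move a (r, w) = c. x (r, w))"
    using False by (simp add: lifted_schroedinger_def tree_root_eq[OF a] sum.reindex inj_on_def)
  also have "\<dots> = (\<Sum>w\<in>V. if (r, w) \<in> E \<and> tree_move a (r, w) = c then x (r, w) else 0)"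
    using finite_V by (intro sum.mono_neutral_cong_left) auto
  also have "\<dots> = (\<Sum>w\<in>V. ?f w)"
    using False loopless by (intro sum.cong refl) (auto simp: schroedinger_def)
  finally show ?thesis .
qed

lemma finite_spanning_trees: "finite (spanning_trees V E)"
  by (rule finite_subset[of _ "Pow E"]) (auto simp: spanning_trees_def spanning_tree_rooted_def finite_E)

text \<open>A walk of trees is determined by its first tree and the walk of its roots, which carries
  the same weight.\<close>

lemma mpow_lifted_schroedinger:
  assumes "spanning_tree_rooted V E a r"
  shows "mpow (spanning_trees V E) (lifted_schroedinger V E x y) k a b = (\<Sum>\<gamma>\<in>walks V k.
    if tree_walk a (r # \<gamma>) = b then walk_weight (schroedinger E x y) (r # \<gamma>) else 0)"
  using assms
proof (induction k arbitrary: a r)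
  case 0
  then show ?case by (simp add: walks_0)
next
  case (Suc k)
  let ?T = "spanning_trees V E" and ?L = "schroedinger E x y"
  let ?m = "\<lambda>c. mpow ?T (lifted_schroedinger V E x y) k c b"
  define s where "s w = (if r = w then a else tree_move a (r, w))" for w
  \<comment> \<open>A nonzero entry belongs to a stationary step or an edge, so the next tree is
    rooted at \<open>w\<close>; where the entry is zero, both sides below vanish.\<close>
  have s: "spanning_tree_rooted V E (s w) w" if "?L r w \<noteq> 0" for w
    using that Suc.prems tree_move_rooted by (auto simp: schroedinger_def s_def split: if_splits)
  have "mpow ?T (lifted_schroedinger V E x y) (Suc k) a b =
      (\<Sum>c\<in>?T. \<Sum>w\<in>V. if s w = c then ?L r w * ?m c else 0)"
    unfolding mpow.simps(2) lifted_schroedinger_eq_sum[OF Suc.prems] s_def[symmetric] sum_distrib_right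
    by (intro sum.cong refl) simp
  also have "\<dots> = (\<Sum>w\<in>V. \<Sum>c\<in>?T. if s w = c then ?L r w * ?m c else 0)"
    by (rule sum.swap)
  also have "\<dots> = (\<Sum>w\<in>V. \<Sum>\<gamma>\<in>walks V k.
      if tree_walk a (r # w # \<gamma>) = b then walk_weight ?L (r # w # \<gamma>) else 0)"
  proof (rule sum.cong[OF refl])
    fix w assume "w \<in> V"
    show "(\<Sum>c\<in>?T. if s w = c then ?L r w * ?m c else 0) = (\<Sum>\<gamma>\<in>walks V k.
        if tree_walk a (r # w # \<gamma>) = b then walk_weight ?L (r # w # \<gamma>) else 0)"
    proof (cases "?L r w = 0")
      case True
      then show ?thesis by simp
    next
      case False
      have "s w \<in> ?T" using s[OF False] by (auto simp: spanning_trees_def)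
      then have "(\<Sum>c\<in>?T. if s w = c then ?L r w * ?m c else 0) = ?L r w * ?m (s w)"
        using finite_spanning_trees by simp
      also have "\<dots> = (\<Sum>\<gamma>\<in>walks V k.
          if tree_walk a (r # w # \<gamma>) = b then walk_weight ?L (r # w # \<gamma>) else 0)"
        unfolding Suc.IH[OF s[OF False]] sum_distrib_left
        by (intro sum.cong refl) (simp add: s_def)
      finally show ?thesis .
    qed
  qed
  finally show ?case unfolding sum_walks_Suc .
qed

text \<open>Both sides are expanded into walks in \<open>V\<close>. A closed walk counts on the left
  once for each tree it fixes, and on the right \<open>m(W)\<close> times for each \<open>W\<close>
  containing its vertices.\<close>

lemma trace_pow_lifted_schroedinger:
  fixes x :: "'v \<times> 'v \<Rightarrow> 'r::comm_ring_1"
  shows "trace_pow (spanning_trees V E) (lifted_schroedinger V E x y) k =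
    (\<Sum>W | strongly_connected_set V E W.
      of_nat (tree_mult V E W (SOME w. w \<in> W)) * trace_pow W (schroedinger E x y) k)"
proof -
  let ?wt = "walk_weight (schroedinger E x y)"
  let ?m = "\<lambda>W. tree_mult V E W (SOME w. w \<in> W)" and ?SC = "{W. strongly_connected_set V E W}"
  have finSC: "finite ?SC" using finite_strongly_connected_sets[of "\<lambda>_. True"] by simp
  \<comment> \<open>The number of fixed trees is the number of forests whose root set is the vertex
    set of the walk, which \<open>sum_tree_mult\<close> splits over the strongly connected sets
    containing it.\<close>
  have count: "?wt (v # \<gamma>) * of_nat (card {a \<in> trees v. tree_walk a (v # \<gamma>) = a}) =
      (\<Sum>W\<in>?SC. of_nat (?m W) *
        (if last (v # \<gamma>) = v \<and> set (v # \<gamma>) \<subseteq> W then ?wt (v # \<gamma>) else 0))"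
    if v: "v \<in> V" "\<gamma> \<in> walks V k" for v \<gamma>
  proof (cases "?wt (v # \<gamma>) = 0")
    case True
    then show ?thesis by simp
  next
    case False
    note walk = successively_if_walk_weight_nonzero[OF False]
    show ?thesis
    proof (cases "last (v # \<gamma>) = v")
      case closed: True
      define U where "U = set (v # \<gamma>)"
      have UV: "U \<subseteq> V" using v by (auto simp: U_def walks_def)
      note bij = bij_betw_closed_walk_trees_forests[OF walk closed U_def UV]
      have "v \<in> U" by (simp add: U_def)
      then have "card (forests V E U) = (\<Sum>W | strongly_connected_set V E W \<and> U \<subseteq> W. tree_mult V E W v)"
        using sum_tree_mult[OF bij(2)] by simp
      also have "\<dots> = (\<Sum>W | strongly_connected_set V E W \<and> U \<subseteq> W. ?m W)"
        using \<open>v \<in> U\<close>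
        by (intro sum.cong refl tree_mult_independent) (auto intro: someI)
      also have "\<dots> = (\<Sum>W\<in>?SC. if U \<subseteq> W then ?m W else 0)"
        using finSC by (intro sum.mono_neutral_cong_left) auto
      finally have "of_nat (card (forests V E U)) = (\<Sum>W\<in>?SC. if U \<subseteq> W then of_nat (?m W) else (0::'r))"
        by (simp add: if_distrib[of of_nat] cong: if_cong)
      then show ?thesis
        using bij_betw_same_card[OF bij(1)] closed unfolding U_def
        by (simp add: sum_distrib_left mult.commute if_distrib cong: if_cong)
    next
      case False
      \<comment> \<open>The lifted walk ends in a tree rooted at its last vertex, so a walk that is
        not closed fixes no tree.\<close>
      then have "tree_walk a (v # \<gamma>) \<noteq> a" if "a \<in> trees v" for a
        using tree_walk_rooted[OF _ walk] spanning_tree_root_unique that by fastforce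
      then have empty: "{a \<in> trees v. tree_walk a (v # \<gamma>) = a} = {}" by blast
      show ?thesis unfolding empty using False by simp
    qed
  qed
  have "spanning_trees V E = (\<Union>v\<in>V. trees v)"
    by (auto simp: spanning_trees_def spanning_tree_rooted_def)
  then have "trace_pow (spanning_trees V E) (lifted_schroedinger V E x y) k =
      (\<Sum>v\<in>V. \<Sum>a\<in>trees v. mpow (spanning_trees V E) (lifted_schroedinger V E x y) k a a)"
    unfolding trace_pow_def using finite_V finite_trees spanning_tree_root_unique
    by (simp only:) (intro sum.UNION_disjoint, auto)
  also have "\<dots> = (\<Sum>v\<in>V. \<Sum>a\<in>trees v. \<Sum>\<gamma>\<in>walks V k. if tree_walk a (v # \<gamma>) = a then ?wt (v # \<gamma>) else 0)"
    by (intro sum.cong refl mpow_lifted_schroedinger) simp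
  also have "\<dots> = (\<Sum>v\<in>V. \<Sum>\<gamma>\<in>walks V k. \<Sum>a\<in>trees v. if tree_walk a (v # \<gamma>) = a then ?wt (v # \<gamma>) else 0)"
    by (intro sum.cong refl sum.swap)
  also have "\<dots> = (\<Sum>v\<in>V. \<Sum>\<gamma>\<in>walks V k. ?wt (v # \<gamma>) * of_nat (card {a \<in> trees v. tree_walk a (v # \<gamma>) = a}))"
    using finite_trees by (intro sum.cong refl) (simp add: sum.If_cases Int_def mult.commute)
  also have "\<dots> = (\<Sum>v\<in>V. \<Sum>\<gamma>\<in>walks V k. \<Sum>W\<in>?SC. of_nat (?m W) *
        (if last (v # \<gamma>) = v \<and> set (v # \<gamma>) \<subseteq> W then ?wt (v # \<gamma>) else 0))"
    by (intro sum.cong refl count)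
  also have "\<dots> = (\<Sum>v\<in>V. \<Sum>W\<in>?SC. \<Sum>\<gamma>\<in>walks V k. of_nat (?m W) *
        (if last (v # \<gamma>) = v \<and> set (v # \<gamma>) \<subseteq> W then ?wt (v # \<gamma>) else 0))"
    by (intro sum.cong refl sum.swap)
  also have "\<dots> = (\<Sum>W\<in>?SC. \<Sum>v\<in>V. \<Sum>\<gamma>\<in>walks V k. of_nat (?m W) *
        (if last (v # \<gamma>) = v \<and> set (v # \<gamma>) \<subseteq> W then ?wt (v # \<gamma>) else 0))"
    by (rule sum.swap)
  also have "\<dots> = (\<Sum>W\<in>?SC. of_nat (?m W) * trace_pow W (schroedinger E x y) k)"
  proof (rule sum.cong[OF refl])
    fix W assume "W \<in> ?SC"
    then have WV: "W \<subseteq> V" by (simp add: strongly_connected_set_def)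
    show "(\<Sum>v\<in>V. \<Sum>\<gamma>\<in>walks V k. of_nat (?m W) *
        (if last (v # \<gamma>) = v \<and> set (v # \<gamma>) \<subseteq> W then ?wt (v # \<gamma>) else 0)) =
        of_nat (?m W) * trace_pow W (schroedinger E x y) k"
      unfolding trace_pow_eq_sum_walks[OF finite_V WV] sum_distrib_left ..
  qed
  finally show ?thesis .
qed

section \<open>The determinant formula over arbitrary commutative rings\<close>

text \<open>All indeterminates share one index type: \<open>Inl e\<close> stands for
  \<open>x e\<close> and \<open>Inr v\<close> for \<open>y v\<close>.\<close>

lemma polyrel_schroedinger:
  assumes "v \<in> V"
  shows "polyrel (Inl ` E \<union> Inr ` V) (\<lambda>\<rho>. schroedinger E (\<rho> \<circ> Inl) (\<rho> \<circ> Inr) v w)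
    (\<lambda>\<rho>. schroedinger E (\<rho> \<circ> Inl) (\<rho> \<circ> Inr) v w)"
proof (cases "v = w")
  case True
  then show ?thesis
    unfolding schroedinger_def o_def using assms
    by (auto simp only: if_True simp_thms intro!: polyrel.add polyrel_uminus polyrel_sum polyrel.var)
next
  case False
  then show ?thesis
    unfolding schroedinger_def o_def
    by (cases "(v, w) \<in> E") (auto intro: polyrel.var polyrel_0)
qed

text \<open>The entry is a sum of Schroedinger entries over a condition on trees that does not
  depend on the ring.\<close>

lemma polyrel_lifted_schroedinger:
  assumes "a \<in> spanning_trees V E"
  shows "polyrel (Inl ` E \<union> Inr ` V) (\<lambda>\<rho>. lifted_schroedinger V E (\<rho> \<circ> Inl) (\<rho> \<circ> Inr) a b)
    (\<lambda>\<rho>. lifted_schroedinger V E (\<rho> \<circ> Inl) (\<rho> \<circ> Inr) a b)"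
proof -
  obtain r where r: "spanning_tree_rooted V E a r" using assms by (auto simp: spanning_trees_def)
  then have "r \<in> V" by (simp add: spanning_tree_rooted_def)
  then have "polyrel (Inl ` E \<union> Inr ` V)
      (\<lambda>\<rho>. if c = b then schroedinger E (\<rho> \<circ> Inl) (\<rho> \<circ> Inr) r w else 0)
      (\<lambda>\<rho>. if c = b then schroedinger E (\<rho> \<circ> Inl) (\<rho> \<circ> Inr) r w else 0)" for c w
    by (cases "c = b") (simp_all add: polyrel_schroedinger polyrel_0)
  then show ?thesis
    unfolding lifted_schroedinger_eq_sum[OF r] by (intro polyrel_sum)
qed

text \<open>The trace identity gives the formula at every complex assignment; both sides are integer
  polynomials in the indeterminates, so it transfers to the given ring.\<close>

lemma det_lifted_schroedinger:
  fixes x :: "'v \<times> 'v \<Rightarrow> 'r::comm_ring_1" and y :: "'v \<Rightarrow> 'r"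
  shows "det_on (spanning_trees V E) (lifted_schroedinger V E x y) =
    (\<Prod>W\<in>{W. strongly_connected_set V E W}.
      det_on W (schroedinger E x y) ^ tree_mult V E W (SOME w. w \<in> W))"
proof -
  let ?I = "Inl ` E \<union> Inr ` V" and ?SC = "{W. strongly_connected_set V E W}"
    and ?m = "\<lambda>W. tree_mult V E W (SOME w. w \<in> W)"
  have finI: "finite ?I" using finite_E finite_V by simp
  have finSC: "finite ?SC" using finite_strongly_connected_sets[of "\<lambda>_. True"] by simp
  have WV: "W \<subseteq> V" if "W \<in> ?SC" for W using that by (simp add: strongly_connected_set_def)
  have left: "polyrel ?I
      (\<lambda>\<rho>::_ \<Rightarrow> complex. det_on (spanning_trees V E) (lifted_schroedinger V E (\<rho> \<circ> Inl) (\<rho> \<circ> Inr)))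
      (\<lambda>\<rho>::_ \<Rightarrow> 'r. det_on (spanning_trees V E) (lifted_schroedinger V E (\<rho> \<circ> Inl) (\<rho> \<circ> Inr)))"
    by (intro polyrel_det_on polyrel_lifted_schroedinger)
  have right: "polyrel ?I
      (\<lambda>\<rho>::_ \<Rightarrow> complex. \<Prod>W\<in>?SC. det_on W (schroedinger E (\<rho> \<circ> Inl) (\<rho> \<circ> Inr)) ^ ?m W)
      (\<lambda>\<rho>::_ \<Rightarrow> 'r. \<Prod>W\<in>?SC. det_on W (schroedinger E (\<rho> \<circ> Inl) (\<rho> \<circ> Inr)) ^ ?m W)"
    using WV by (intro polyrel_prod polyrel_power polyrel_det_on polyrel_schroedinger) blast
  have "det_on (spanning_trees V E) (lifted_schroedinger V E (\<rho> \<circ> Inl) (\<rho> \<circ> Inr)) =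
      (\<Prod>W\<in>?SC. det_on W (schroedinger E (\<rho> \<circ> Inl) (\<rho> \<circ> Inr)) ^ ?m W)"
    for \<rho> :: "_ \<Rightarrow> complex"
    using finite_subset[OF WV finite_V]
    by (intro det_on_eq_prod_if_trace_pow_eq finite_spanning_trees finSC trace_pow_lifted_schroedinger)
  \<comment> \<open>The assignment \<open>case_sum x y\<close> restores the given weights.\<close>
  from polyrel_eq_transfer[OF finI left right this, of "case_sum x y"]
  show ?thesis by (simp add: o_def)
qed

end

theorem mainTheorem1:
  fixes V :: "'v::linorder set" and E :: "('v \<times> 'v) set"
    and x :: "'v \<times> 'v \<Rightarrow> 'r::comm_ring_1" and y :: "'v \<Rightarrow> 'r"
  assumes "finite V" and "E \<subseteq> V \<times> V" and "\<forall>v. (v, v) \<notin> E"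
    and "strongly_connected_set V E V"
  shows "(\<forall>W w1 w2. strongly_connected_set V E W \<longrightarrow> w1 \<in> W \<longrightarrow> w2 \<in> W \<longrightarrow>
            tree_mult V E W w1 = tree_mult V E W w2)
       \<and> det_on (spanning_trees V E) (lifted_schroedinger V E x y) =
         (\<Prod>W\<in>{W. strongly_connected_set V E W}.
            det_on W (schroedinger E x y) ^ tree_mult V E W (SOME w. w \<in> W))"
proof -
  interpret loopless_digraph V E
    using assms(1-3) by unfold_locales
  show ?thesis
    using tree_mult_independent det_lifted_schroedinger by blast
qed

end
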